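(* Let $\mu_0=\mathcal N(m_0,\Sigma_0)\in\mathcal G$ (so $m_0\in\mathbb R^n$, $\Sigma_0\in S_n^+$) and let $(m_a,\Sigma_a)\in\mathbb R^n\times S_n$ be an initial velocity. Let $A\in S_n$ and $b\in\mathbb R^n$ be the unique solutions of $$A\Sigma_0+\Sigma_0A=\Sigma_a,\qquad Am_0+b=m_a.$$ Then the curve $$\gamma_1(t)=\mathcal N(m_t,\Sigma_t),\qquad m_t=e^{tA}m_0+K_t(A)b,\qquad \Sigma_t=e^{tA}\Sigma_0e^{tA},\qquad K_t(A):=\int_0^te^{sA}\,ds,$$ is the unique $e_1$-geodesic with initial point $\mu_0$ and initial velocity $(m_a,\Sigma_a)$, and it belongs to $\mathcal G$ for every $t\in\mathbb R$. Hence the $e_1$-connection on $\mathcal G$ is geodesically complete, i.e. every $e_1$-geodesic with prescribed initial position and velocity is defined for every $t\in\mathbb R$. A limit of $\gamma_1(t)$ as $t\to+\infty$ exists in the closure of the Gaussian family if and only if $$A\preceq0\qquad\text{and}\qquad A^{\perp}b=0.$$ When these conditions hold, $$\gamma_1(t)\Longrightarrow\mathcal N\bigl(A^{\perp}m_0-A^{\dagger}b,\;A^{\perp}\Sigma_0A^{\perp}\bigr)\qquad(t\to+\infty),$$ where the Gaussian on the right may be degenerate. In particular, if $A\prec0$, the limit is the Dirac measure $\delta_{-A^{-1}b}$. The limit lies in $\mathcal G$ only for the constant geodesic $A=0$, $b=0$.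
   Context: $S_n$ is the space of real symmetric $n\times n$ matrices and $S_n^+\subset S_n$ the open cone of positive definite ones. $\mathcal G=\{\mathcal N(m,\Sigma):m\in\mathbb R^n,\Sigma\in S_n^+\}$ is the manifold of nondegenerate Gaussian measures on $\mathbb R^n$, with smooth structure given by the global chart $(m,\Sigma)$; a tangent vector at $\mu=\mathcal N(m,\Sigma)$ is described by its coordinate velocity $(m_v,\Sigma_v)\in\mathbb R^n\times S_n$. For symmetric $A$, $A^\dagger$ is the Moore--Penrose pseudoinverse and $A^\perp:=I-AA^\dagger$ is the orthogonal projector onto $\ker A$; $A\preceq 0$ ($A\prec0$) means negative semidefinite (definite). The $e_1$-connection. To a tangent vector $(m_v,\Sigma_v)$ at $\mathcal N(m,\Sigma)\in\mathcal G$ associate the unique pair $(A,b)\in S_n\times\mathbb R^n$ with $A\Sigma+\Sigma A=\Sigma_v$ and $Am+b=m_v$ (equivalently, the quadratic potential $f(x)=\frac12x^\top Ax+b^\top x$ modulo constants; this is the Otto cotangent representative of the tangent vector). The $e_1$-parallel transport from $\mu$ to $\nu=\mathcal N(m_\nu,\Sigma_\nu)$ keeps $(A,b)$ fixed, i.e. it sends that tangent vector to the tangent vector at $\nu$ with coordinate velocity $(Am_\nu+b,\;A\Sigma_\nu+\Sigma_\nu A)$. A curve in $\mathcal G$ is an $e_1$-geodesic if its velocity at each time $t$ is the $e_1$-parallel transport of its velocity at time $0$; in coordinates, $\dot m_t=Am_t+b$ and $\dot\Sigma_t=A\Sigma_t+\Sigma_tA$ with $(A,b)$ the constant pair determined by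 the initial data. The closure of the Gaussian family is the set of all Gaussian measures $\mathcal N(m,\Sigma)$ with $m\in\mathbb R^n$, $\Sigma\succeq0$ (possibly degenerate, with $\mathcal N(m,0)=\delta_m$); limits and $\Longrightarrow$ refer to weak convergence of probability measures. *)

theory Defs
  imports "HOL-Probability.Probability"
begin

section \<open>Symmetric matrices\<close>

definition symmetric_mat :: "real^'n^'n \<Rightarrow> bool" where
  "symmetric_mat A \<longleftrightarrow> transpose A = A"

definition pos_semidef :: "real^'n^'n \<Rightarrow> bool" where
  "pos_semidef A \<longleftrightarrow> symmetric_mat A \<and> (\<forall>x. 0 \<le> x \<bullet> (A *v x))"

definition pos_def :: "real^'n^'n \<Rightarrow> bool" where
  "pos_def A \<longleftrightarrow> symmetric_mat A \<and> (\<forall>x. x \<noteq> 0 \<longrightarrow> 0 < x \<bullet> (A *v x))"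

definition neg_semidef :: "real^'n^'n \<Rightarrow> bool" where
  "neg_semidef A \<longleftrightarrow> symmetric_mat A \<and> (\<forall>x. x \<bullet> (A *v x) \<le> 0)"

definition neg_def :: "real^'n^'n \<Rightarrow> bool" where
  "neg_def A \<longleftrightarrow> symmetric_mat A \<and> (\<forall>x. x \<noteq> 0 \<longrightarrow> x \<bullet> (A *v x) < 0)"

definition psd_sqrt :: "real^'n^'n \<Rightarrow> real^'n^'n" where
  "psd_sqrt S = (THE R. pos_semidef R \<and> R ** R = S)"

text \<open>The Moore--Penrose pseudoinverse, by the four Penrose equations.\<close>

definition pinv :: "real^'n^'n \<Rightarrow> real^'n^'n" where
  "pinv A = (THE X. A ** X ** A = A \<and> X ** A ** X = X \<and>
     symmetric_mat (A ** X) \<and> symmetric_mat (X ** A))"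

definition ker_proj :: "real^'n^'n \<Rightarrow> real^'n^'n" where
  "ker_proj A = mat 1 - A ** pinv A"

text \<open>
  The generic \<open>exp\<close> is not available here, because square matrices under \<open>**\<close> are
  not an instance of \<open>real_normed_algebra_1\<close>.
\<close>

definition mat_exp :: "real^'n^'n \<Rightarrow> real^'n^'n" where
  "mat_exp A = (\<Sum>k. (1 / fact k) *\<^sub>R (((**) A ^^ k) (mat 1)))"

text \<open>For \<open>t < 0\<close> the interval integral below is the oriented one, \<open>\<integral>\<^sub>0\<^sup>t = - \<integral>\<^sub>t\<^sup>0\<close>.\<close>

definition exp_integral :: "real \<Rightarrow> real^'n^'n \<Rightarrow> real^'n^'n" where
  "exp_integral t A = (LBINT s=0..ereal t. mat_exp (s *\<^sub>R A))"


section \<open>Gaussian measures\<close>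

definition std_gaussian :: "(real^'n) measure" where
  "std_gaussian = density lborel (\<lambda>x. ennreal (\<Prod>i\<in>UNIV. std_normal_density (x $ i)))"

text \<open>
  The law of \<open>m + S\<^sup>1\<^sup>/\<^sup>2 Z\<close> with \<open>Z\<close> standard Gaussian. It is meant for positive
  semidefinite \<open>S\<close>; singular \<open>S\<close> give the degenerate Gaussians, and \<open>S = 0\<close> the
  Dirac measure at \<open>m\<close>.
\<close>

definition gaussian :: "real^'n \<Rightarrow> real^'n^'n \<Rightarrow> (real^'n) measure" where
  "gaussian m S = distr std_gaussian borel (\<lambda>z. m + psd_sqrt S *v z)"

definition nondeg_gaussians :: "(real^'n) measure set" where
  "nondeg_gaussians = {gaussian m S | m S. pos_def S}"

definition closed_gaussians :: "(real^'n) measure set" where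
  "closed_gaussians = {gaussian m S | m S. pos_semidef S}"

definition weak_limit ::
  "('t \<Rightarrow> 'a::topological_space measure) \<Rightarrow> 'a measure \<Rightarrow> 't filter \<Rightarrow> bool" where
  "weak_limit \<mu> M F \<longleftrightarrow>
     (\<forall>f::'a \<Rightarrow> real. continuous_on UNIV f \<and> bounded (range f) \<longrightarrow>
        ((\<lambda>t. integral\<^sup>L (\<mu> t) f) \<longlongrightarrow> integral\<^sup>L M f) F)"


section \<open>The $e_1$-connection\<close>

text \<open>The global chart \<open>(m, S)\<close> of the manifold of nondegenerate Gaussians.\<close>

definition gauss_chart :: "(real^'n) measure \<Rightarrow> (real^'n) \<times> (real^'n^'n)" where
  "gauss_chart = the_inv_into {(m, S). pos_def S} (\<lambda>(m, S). gaussian m S)"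

text \<open>Coordinate velocity of a curve at time \<open>t\<close>, one-sided at an endpoint of \<open>J\<close>.\<close>

definition has_gauss_velocity ::
  "(real \<Rightarrow> (real^'n) measure) \<Rightarrow> real set \<Rightarrow> real \<Rightarrow> (real^'n) \<times> (real^'n^'n) \<Rightarrow> bool" where
  "has_gauss_velocity \<gamma> J t v \<longleftrightarrow>
     ((\<lambda>s. gauss_chart (\<gamma> s)) has_vector_derivative v) (at t within J)"

definition otto_rep ::
  "(real^'n) measure \<Rightarrow> (real^'n) \<times> (real^'n^'n) \<Rightarrow> (real^'n^'n) \<times> (real^'n)" where
  "otto_rep \<mu> v = (let (m, S) = gauss_chart \<mu>; (mv, Sv) = v in
     (THE p. case p of (A, b) \<Rightarrow>
        symmetric_mat A \<and> A ** S + S ** A = Sv \<and> A *v m + b = mv))"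

definition e1_transport ::
  "(real^'n) measure \<Rightarrow> (real^'n) measure \<Rightarrow>
   (real^'n) \<times> (real^'n^'n) \<Rightarrow> (real^'n) \<times> (real^'n^'n)" where
  "e1_transport \<mu> \<nu> v = (let (A, b) = otto_rep \<mu> v; (m, S) = gauss_chart \<nu> in
     (A *v m + b, A ** S + S ** A))"

text \<open>
  Geodesics on a nondegenerate interval \<open>J\<close> containing \<open>0\<close>. The excluded case
  \<open>J = {0}\<close> carries no velocity information.
\<close>

definition e1_geodesic_on :: "real set \<Rightarrow> (real \<Rightarrow> (real^'n) measure) \<Rightarrow> bool" where
  "e1_geodesic_on J \<gamma> \<longleftrightarrow>
     is_interval J \<and> 0 \<in> J \<and> J \<noteq> {0} \<and>
     (\<forall>t\<in>J. \<gamma> t \<in> nondeg_gaussians) \<and>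
     (\<exists>v. has_gauss_velocity \<gamma> J 0 v \<and>
        (\<forall>t\<in>J. has_gauss_velocity \<gamma> J t (e1_transport (\<gamma> 0) (\<gamma> t) v)))"

definition e1_geodesic_from ::
  "(real^'n) measure \<Rightarrow> (real^'n) \<times> (real^'n^'n) \<Rightarrow> real set \<Rightarrow>
   (real \<Rightarrow> (real^'n) measure) \<Rightarrow> bool" where
  "e1_geodesic_from \<mu> v J \<gamma> \<longleftrightarrow>
     e1_geodesic_on J \<gamma> \<and> \<gamma> 0 = \<mu> \<and> has_gauss_velocity \<gamma> J 0 v"

text \<open>
  For all initial data, there is a geodesic defined for all times, and every geodesic with
  these data is a restriction of it. The argument only fixes the dimension.
\<close>

definition e1_geodesically_complete :: "'n::finite itself \<Rightarrow> bool" where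
  "e1_geodesically_complete _ \<longleftrightarrow>
     (\<forall>(\<mu>::(real^'n) measure) \<in> nondeg_gaussians. \<forall>mv Sv. symmetric_mat Sv \<longrightarrow>
        (\<exists>\<gamma>. e1_geodesic_from \<mu> (mv, Sv) UNIV \<gamma> \<and>
           (\<forall>J \<delta>. e1_geodesic_from \<mu> (mv, Sv) J \<delta> \<longrightarrow> (\<forall>t\<in>J. \<delta> t = \<gamma> t))))"

end

theory Submission
  imports Defs
begin

text \<open>
  In the coordinates \<open>(m, \<Sigma>)\<close> an e1-geodesic solves the constant-coefficient linear system
  \<open>m' = A m + b\<close>, \<open>\<Sigma>' = A \<Sigma> + \<Sigma> A\<close>. The pair \<open>(A, b)\<close> exists and is unique because the
  Lyapunov operator \<open>X \<mapsto> X \<Sigma> + \<Sigma> X\<close> is injective for positive definite \<open>\<Sigma>\<close>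
  (\<open>lyapunov_injective\<close>): in an eigenbasis of \<open>\<Sigma>\<close> it multiplies each entry by a sum of two
  positive eigenvalues. Since \<open>A\<close> is symmetric it has an orthonormal eigenbasis
  (\<open>spectral_theorem\<close>), in which \<open>e\<^sup>t\<^sup>A\<close>, \<open>K\<^sub>t(A)\<close>, the pseudoinverse and the projector onto the
  kernel are all diagonal. So the explicit curve solves the system by a computation with scalar
  functions, and two solutions agree because the entries of their difference each solve a scalar
  equation \<open>x' = c x\<close> with \<open>x(0) = 0\<close>. The curve stays nondegenerate since \<open>e\<^sup>t\<^sup>A\<close> is
  invertible.

  Everything about Gaussian measures rests on one integral, the real form of the characteristic
  function (\<open>integral_cos_gaussian\<close>): integrating \<open>cos (\<xi> \<bullet> x + c)\<close> against \<open>N(m, \<Sigma>)\<close> gives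
  \<open>cos (\<xi> \<bullet> m + c) * exp (- (\<xi> \<bullet> \<Sigma> \<xi>) / 2)\<close>. These numbers determine \<open>m\<close> and \<open>\<Sigma>\<close>, also for
  singular \<open>\<Sigma>\<close>; hence the chart is injective and weak limits have unique parameters.

  If the curve has a Gaussian weak limit, these numbers converge to a function of \<open>\<xi>\<close> and \<open>c\<close>
  that is nonzero for a suitable \<open>c\<close>. Along an eigenvector of \<open>A\<close> with a positive eigenvalue the
  variance explodes and they tend to \<open>0\<close>. Along an eigenvector \<open>e\<close> in the kernel the variance is
  constant while the mean moves with constant speed \<open>e \<bullet> b\<close>, so if this speed is nonzero they
  oscillate forever. Excluding both cases says precisely that \<open>A\<close> is negative semidefinite and the
  kernel component of \<open>b\<close> vanishes. Under these conditions \<open>m\<^sub>t\<close> and \<open>\<Sigma>\<^sub>t\<close> converge, and weak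
  convergence follows from dominated convergence once the square root of a positive semidefinite
  matrix is known to be continuous (\<open>tendsto_psd_sqrt_mult_vector\<close>). The limit covariance
  \<open>ker_proj A ** \<Sigma>\<^sub>0 ** ker_proj A\<close> is singular as soon as \<open>A\<close> has a nonzero eigenvalue, so a nondegenerate limit
  forces \<open>A = 0\<close> and then \<open>b = 0\<close>.
\<close>

section \<open>The spectral theorem for symmetric matrices\<close>

lemma bounded_linear_mult_vector: "bounded_linear (\<lambda>M :: real^'n^'n. M *v x)"
  unfolding linear_conv_bounded_linear[symmetric]
  by (intro linearI) (simp_all add: matrix_vector_mult_add_rdistrib scaleR_matrix_vector_assoc)

lemma bounded_bilinear_matrix_mult: "bounded_bilinear ((**) :: real^'n^'n \<Rightarrow> real^'n^'n \<Rightarrow> real^'n^'n)"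
  unfolding bilinear_conv_bounded_bilinear[symmetric] bilinear_def
  by (auto intro!: linearI simp: vec_eq_iff matrix_matrix_mult_def sum.distrib[symmetric]
      sum_distrib_left algebra_simps)

lemma symmetric_mat_inner:
  assumes "symmetric_mat A"
  shows "(A *v x) \<bullet> y = x \<bullet> (A *v y)"
  using assms by (metis dot_lmul_matrix symmetric_mat_def transpose_matrix_vector)

lemma symmetric_mat_diff:
  assumes "symmetric_mat S" "symmetric_mat T"
  shows "symmetric_mat (S - T)"
  using assms by (simp add: symmetric_mat_def transpose_def vec_eq_iff)

lemma congruence_quadratic_form:
  assumes "symmetric_mat M"
  shows "x \<bullet> ((M ** S ** M) *v x) = (M *v x) \<bullet> (S *v (M *v x))"
  by (simp add: symmetric_mat_inner[OF assms] matrix_vector_mul_assoc matrix_mul_assoc)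

lemma symmetric_congruence:
  assumes "symmetric_mat M" "symmetric_mat S"
  shows "symmetric_mat (M ** S ** M)"
  using assms by (simp add: symmetric_mat_def matrix_transpose_mul matrix_mul_assoc)

lemma pos_semidef_congruence:
  assumes "symmetric_mat M" "pos_semidef S"
  shows "pos_semidef (M ** S ** M)"
  using assms by (simp add: pos_semidef_def symmetric_congruence congruence_quadratic_form)

text \<open>
  The first-order condition at a minimum, for a quadratic polynomial in \<open>t\<close> with minimum value \<open>0\<close>
  attained at \<open>t = 0\<close>.
\<close>

lemma linear_coefficient_zero:
  fixes a q :: real
  assumes "\<And>t. 0 \<le> 2 * t * a + t\<^sup>2 * q"
  shows "a = 0"
proof (rule ccontr)
  assume "a \<noteq> 0"
  define k where "k = \<bar>q\<bar> + 1"
  have k: "k > 0" "q < k" by (auto simp: k_def)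
  \<comment> \<open>Any positive \<open>k > q / 2\<close> makes the value at \<open>t = - a / k\<close> negative.\<close>
  have "0 \<le> 2 * (- a / k) * a + (- a / k)\<^sup>2 * q" by (rule assms)
  also have "\<dots> = (a\<^sup>2 / k) * (q / k - 2)"
    using k by (simp add: field_simps power2_eq_square)
  also have "\<dots> < 0"
    using k \<open>a \<noteq> 0\<close> by (intro mult_pos_neg) (auto simp: field_simps)
  finally show False by simp
qed

text \<open>
  A maximiser \<open>v\<close> of the Rayleigh quotient on the unit sphere of \<open>W\<close> is an eigenvector: with \<open>c\<close> the
  maximum, the quadratic form \<open>c (x \<bullet> x) - x \<bullet> A x\<close> is nonnegative on \<open>W\<close> and vanishes at \<open>v\<close>,
  so its derivative at \<open>v\<close> in the direction \<open>c v - A v\<close> is zero, and this derivative is twice the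
  squared length of that direction.
\<close>

lemma symmetric_mat_eigenvector:
  fixes A :: "real^'n^'n"
  assumes sym: "symmetric_mat A" and W: "subspace W" "\<And>x. x \<in> W \<Longrightarrow> A *v x \<in> W"
    and nontriv: "W \<noteq> {0}"
  obtains v c where "v \<in> W" "norm v = 1" "A *v v = c *\<^sub>R v"
proof -
  let ?S = "W \<inter> sphere 0 1"
  obtain w where w: "w \<in> W" "w \<noteq> 0" using W(1) nontriv subspace_0 by blast
  then have "(1 / norm w) *\<^sub>R w \<in> ?S" using W(1) by (auto simp: subspace_scale)
  then have ne: "?S \<noteq> {}" by blast
  have comp: "compact ?S" using closed_subspace[OF W(1)] by (intro closed_Int_compact) auto
  have cont: "continuous_on ?S (\<lambda>x. x \<bullet> (A *v x))"
    by (intro continuous_intros linear_continuous_on matrix_vector_mul_bounded_linear)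
  obtain v where v: "v \<in> ?S" and vmax: "\<And>x. x \<in> ?S \<Longrightarrow> x \<bullet> (A *v x) \<le> v \<bullet> (A *v v)"
    using continuous_attains_sup[OF comp ne cont] by blast
  define c where "c = v \<bullet> (A *v v)"
  define Q where "Q x = c * (x \<bullet> x) - x \<bullet> (A *v x)" for x
  have vv: "v \<bullet> v = 1" using v by (simp add: norm_eq_1)
  have Qpos: "Q x \<ge> 0" if "x \<in> W" for x
  proof (cases "x = 0")
    case False
    have "(1 / norm x) *\<^sub>R x \<in> ?S" using that W(1) False by (auto simp: subspace_scale)
    from vmax[OF this] have "(x \<bullet> (A *v x)) / (norm x)\<^sup>2 \<le> c"
      by (simp add: matrix_vector_mult_scaleR c_def power2_eq_square)
    then show ?thesis using False
      by (simp add: Q_def divide_le_eq power2_norm_eq_inner)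
  qed (simp add: Q_def)
  define u where "u = c *\<^sub>R v - A *v v"
  have uW: "u \<in> W" using v W by (auto simp: u_def intro!: subspace_diff subspace_scale)
  have "u \<bullet> u = 0"
  proof (rule linear_coefficient_zero)
    fix t :: real
    have "0 \<le> Q (v + t *\<^sub>R u)" using v uW W(1) by (intro Qpos subspace_add subspace_scale) auto
    also have "\<dots> = 2 * t * (u \<bullet> u) + t\<^sup>2 * Q u"
      using symmetric_mat_inner[OF sym, of v u] vv
      unfolding Q_def
      by (simp add: u_def c_def[symmetric] matrix_vector_right_distrib matrix_vector_mult_scaleR
          inner_commute algebra_simps power2_eq_square inner_add_left inner_add_right
          inner_diff_left inner_diff_right)
    finally show "0 \<le> 2 * t * (u \<bullet> u) + t\<^sup>2 * Q u" .
  qed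
  then have "A *v v = c *\<^sub>R v" by (simp add: u_def)
  with v that show thesis by auto
qed

text \<open>
  Invariant subspaces make the induction on the dimension work: the orthogonal complement in \<open>W\<close> of
  an eigenvector is again invariant, because \<open>A\<close> is symmetric.
\<close>

lemma symmetric_mat_eigenbasis_subspace:
  fixes A :: "real^'n^'n"
  assumes sym: "symmetric_mat A"
  shows "subspace W \<Longrightarrow> (\<And>x. x \<in> W \<Longrightarrow> A *v x \<in> W) \<Longrightarrow>
    \<exists>B\<subseteq>W. pairwise orthogonal B \<and> (\<forall>v\<in>B. norm v = 1 \<and> (\<exists>c. A *v v = c *\<^sub>R v)) \<and> W \<subseteq> span B"
proof (induction "dim W" arbitrary: W rule: less_induct)
  case less
  show ?case
  proof (cases "W = {0}")
    case True
    then show ?thesis by (intro exI[of _ "{}"]) auto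
  next
    case False
    obtain v c where v: "v \<in> W" "norm v = 1" "A *v v = c *\<^sub>R v"
      using symmetric_mat_eigenvector[OF sym less.prems False] by blast
    define W' where "W' = {x \<in> W. v \<bullet> x = 0}"
    have sub': "subspace W'"
      using less.prems(1) by (auto simp: W'_def subspace_def inner_add_right)
    have inv': "A *v x \<in> W'" if "x \<in> W'" for x
      using that less.prems(2) symmetric_mat_inner[OF sym, of v x] v(3) by (auto simp: W'_def)
    have "v \<notin> W'" using v(2) by (auto simp: W'_def)
    moreover have "W' \<subseteq> W" by (auto simp: W'_def)
    ultimately have "W' \<subset> W" using v(1) by blast
    then have "dim W' < dim W"
      using sub' less.prems(1) by (intro dim_psubset) (metis span_eq_iff)
    from less.hyps[OF this sub' inv'] obtain B where B: "B \<subseteq> W'" "pairwise orthogonal B"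
      "\<forall>v\<in>B. norm v = 1 \<and> (\<exists>c. A *v v = c *\<^sub>R v)" "W' \<subseteq> span B" by blast
    have "W \<subseteq> span (insert v B)"
    proof
      fix x assume x: "x \<in> W"
      have "x - (v \<bullet> x) *\<^sub>R v \<in> W'"
        using x v less.prems(1)
        by (auto simp: W'_def inner_diff_right norm_eq_1 intro!: subspace_diff subspace_scale)
      then have "x - (v \<bullet> x) *\<^sub>R v \<in> span B" using B(4) by blast
      then show "x \<in> span (insert v B)" by (auto simp: span_insert)
    qed
    moreover have "pairwise orthogonal (insert v B)"
      using B(1,2) by (auto simp: pairwise_insert W'_def orthogonal_def inner_commute)
    ultimately show ?thesis
      using B v(1) v(2,3) \<open>W' \<subset> W\<close> by (intro exI[of _ "insert v B"]) auto
  qed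
qed

definition orthonormal_frame :: "('n \<Rightarrow> real^'n) \<Rightarrow> bool" where
  "orthonormal_frame e \<longleftrightarrow> (\<forall>i j. e i \<bullet> e j = (if i = j then 1 else 0))"

text \<open>
  The functional calculus of a symmetric matrix: if \<open>A\<close> has eigenvalue \<open>c i\<close> on the frame vector
  \<open>e i\<close>, then \<open>spectral e (\<lambda>i. h (c i))\<close> is the matrix \<open>h(A)\<close>. As a sum of fixed rank-one matrices
  with scalar coefficients it inherits limits, derivatives and series from the coefficients.
\<close>

definition spectral :: "('n \<Rightarrow> real^'n) \<Rightarrow> ('n \<Rightarrow> real) \<Rightarrow> real^'n^'n" where
  "spectral e f = (\<Sum>i\<in>UNIV. f i *\<^sub>R (\<chi> a b. e i $ a * e i $ b))"

lemma spectral_mult_vector: "spectral e f *v x = (\<Sum>i\<in>UNIV. (f i * (e i \<bullet> x)) *\<^sub>R e i)"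
proof -
  have "(\<Sum>j\<in>UNIV. (\<Sum>i\<in>UNIV. f i * (e i $ a * e i $ j)) * x $ j)
      = (\<Sum>i\<in>UNIV. f i * (\<Sum>j\<in>UNIV. e i $ j * x $ j) * e i $ a)" for a
    unfolding sum_distrib_left sum_distrib_right
    by (subst sum.swap) (simp add: mult_ac)
  then show ?thesis
    by (simp add: vec_eq_iff matrix_vector_mult_def spectral_def inner_vec_def)
qed

lemma symmetric_spectral: "symmetric_mat (spectral e f)"
  by (simp add: symmetric_mat_def spectral_def vec_eq_iff transpose_def mult.commute)

lemma spectral_mult_frame:
  assumes "orthonormal_frame e"
  shows "spectral e f *v e i = f i *\<^sub>R e i"
proof -
  have "spectral e f *v e i = (\<Sum>j\<in>UNIV. if j = i then f i *\<^sub>R e i else 0)"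
    unfolding spectral_mult_vector
    by (rule sum.cong) (use assms in \<open>auto simp: orthonormal_frame_def\<close>)
  then show ?thesis by simp
qed

lemma inner_frame_spectral:
  assumes "orthonormal_frame e"
  shows "e i \<bullet> (spectral e f *v x) = f i * (e i \<bullet> x)"
  using symmetric_mat_inner[OF symmetric_spectral[of e f], of "e i" x]
  by (simp add: spectral_mult_frame[OF assms])

lemma spectral_one:
  fixes e :: "'n::finite \<Rightarrow> real^'n"
  assumes "orthonormal_frame e"
  shows "spectral e (\<lambda>_. 1) = mat 1"
proof -
  define P :: "real^'n^'n" where "P = (\<chi> i a. e i $ a)"
  have "P ** transpose P = mat 1"
    using assms
    by (simp add: vec_eq_iff matrix_matrix_mult_def transpose_def P_def mat_def
        orthonormal_frame_def inner_vec_def)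
  \<comment> \<open>Orthonormality of the rows of a square matrix passes to its columns; this is completeness.\<close>
  then have "transpose P ** P = mat 1" by (simp add: matrix_left_right_inverse)
  then show ?thesis
    by (simp add: vec_eq_iff matrix_matrix_mult_def transpose_def P_def spectral_def)
qed

lemma frame_expansion:
  fixes e :: "'n::finite \<Rightarrow> real^'n"
  assumes "orthonormal_frame e"
  shows "x = (\<Sum>i\<in>UNIV. (e i \<bullet> x) *\<^sub>R e i)"
  using spectral_mult_vector[of e "\<lambda>_. 1" x] by (simp add: spectral_one[OF assms])

lemma frame_vector_eqI:
  fixes e :: "'n::finite \<Rightarrow> real^'n"
  assumes "orthonormal_frame e" "\<And>i. e i \<bullet> x = e i \<bullet> y"
  shows "x = y"
  using frame_expansion[OF assms(1), of x] frame_expansion[OF assms(1), of y] assms(2) by simp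

lemma frame_matrix_eqI:
  fixes e :: "'n::finite \<Rightarrow> real^'n"
  assumes "orthonormal_frame e" "\<And>i. M *v e i = N *v e i"
  shows "M = N"
proof -
  have "M *v x = N *v x" for x
    by (subst (1 2) frame_expansion[OF assms(1), of x])
      (simp add: linear_sum[OF matrix_vector_mul_linear] matrix_vector_mult_scaleR assms(2))
  then show ?thesis by (simp add: matrix_eq)
qed

lemma spectral_mult:
  fixes e :: "'n::finite \<Rightarrow> real^'n"
  assumes "orthonormal_frame e"
  shows "spectral e f ** spectral e g = spectral e (\<lambda>i. f i * g i)"
  by (rule frame_matrix_eqI[OF assms])
    (simp add: matrix_vector_mul_assoc[symmetric] spectral_mult_frame[OF assms]
      matrix_vector_mult_scaleR mult.commute)

theorem spectral_theorem:
  fixes A :: "real^'n^'n"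
  assumes "symmetric_mat A"
  obtains e c where "orthonormal_frame e" "A = spectral e c"
proof -
  obtain B where B: "pairwise orthogonal B"
      "\<forall>v\<in>B. norm v = 1 \<and> (\<exists>c. A *v v = c *\<^sub>R v)" "UNIV \<subseteq> span B"
    using symmetric_mat_eigenbasis_subspace[OF assms, of UNIV] by auto
  have ind: "independent B" using B(1,2) by (intro pairwise_orthogonal_independent) auto
  then have fin: "finite B" by (rule independent_imp_finite)
  have "card B = CARD('n)"
    using dim_eq_card[OF _ ind, of UNIV] B(3) by (simp add: top.extremum_unique)
  then obtain e where e: "bij_betw e (UNIV :: 'n set) B"
    using finite_same_card_bij[OF _ fin, of "UNIV :: 'n set"] by auto
  have eB: "e i \<in> B" for i using e by (auto simp: bij_betw_def)
  have "e i \<bullet> e j = (if i = j then 1 else 0)" for i j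
    using eB[of i] eB[of j] e B(1,2)
    by (auto simp: norm_eq_1 pairwise_def orthogonal_def bij_betw_def dest: injD)
  then have on: "orthonormal_frame e" by (simp add: orthonormal_frame_def)
  have "\<forall>i. \<exists>c. A *v e i = c *\<^sub>R e i" using eB B(2) by blast
  then obtain c where c: "\<And>i. A *v e i = c i *\<^sub>R e i" by metis
  have "A = spectral e c"
    by (rule frame_matrix_eqI[OF on]) (simp add: c spectral_mult_frame[OF on])
  with on that show thesis by blast
qed

section \<open>Functions of a symmetric matrix\<close>

lemma spectral_diff: "spectral e f - spectral e g = spectral e (\<lambda>i. f i - g i)"
  by (simp add: spectral_def scaleR_diff_left sum_subtractf)

lemma scaleR_spectral: "t *\<^sub>R spectral e f = spectral e (\<lambda>i. t * f i)"
  by (simp add: spectral_def scaleR_sum_right)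

lemma spectral_zero: "spectral e (\<lambda>_. 0) = 0"
  by (simp add: spectral_def)

lemma spectral_has_vector_derivative:
  assumes "\<And>i. ((\<lambda>t. f t i) has_real_derivative f' i) (at t within J)"
  shows "((\<lambda>t. spectral e (f t)) has_vector_derivative spectral e f') (at t within J)"
  unfolding spectral_def
  by (intro has_vector_derivative_sum)
    (use assms in \<open>auto intro!: derivative_eq_intros simp: has_real_derivative_iff_has_vector_derivative\<close>)

lemma spectral_quadratic_form:
  "x \<bullet> (spectral e c *v x) = (\<Sum>i\<in>UNIV. c i * (e i \<bullet> x)\<^sup>2)"
  by (simp add: spectral_mult_vector inner_sum_right power2_eq_square inner_commute mult.assoc)

lemma frame_quadratic_form:
  assumes "orthonormal_frame e"
  shows "e i \<bullet> (spectral e c *v e i) = c i"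
  using assms by (simp add: spectral_mult_frame orthonormal_frame_def)

lemma frame_nonzero: "orthonormal_frame e \<Longrightarrow> e i \<noteq> 0"
  by (metis inner_zero_left orthonormal_frame_def zero_neq_one)

lemma frame_norm: "orthonormal_frame e \<Longrightarrow> norm (e i) = 1"
  by (simp add: orthonormal_frame_def norm_eq_1)

lemma symmetric_mat_eqI:
  fixes S T :: "real^'n^'n"
  assumes "symmetric_mat S" "symmetric_mat T" "\<And>x. x \<bullet> (S *v x) = x \<bullet> (T *v x)"
  shows "S = T"
proof -
  have "symmetric_mat (S - T)"
    using assms(1,2) by (rule symmetric_mat_diff)
  then obtain e c where e: "orthonormal_frame e" "S - T = spectral e c"
    by (rule spectral_theorem)
  have "c i = 0" for i
    using frame_quadratic_form[OF e(1), of i c] assms(3)[of "e i"]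
    by (simp add: e(2)[symmetric] matrix_vector_mult_diff_rdistrib inner_diff_right)
  then have "c = (\<lambda>_. 0)" by auto
  then show ?thesis using e(2) by (simp add: spectral_zero)
qed

lemma neg_semidef_spectral:
  assumes "orthonormal_frame e"
  shows "neg_semidef (spectral e c) \<longleftrightarrow> (\<forall>i. c i \<le> 0)"
proof
  show "neg_semidef (spectral e c) \<Longrightarrow> \<forall>i. c i \<le> 0"
    unfolding neg_semidef_def by (metis frame_quadratic_form[OF assms])
  show "\<forall>i. c i \<le> 0 \<Longrightarrow> neg_semidef (spectral e c)"
    by (simp add: neg_semidef_def symmetric_spectral spectral_quadratic_form
        sum_nonpos mult_nonpos_nonneg)
qed

lemma pos_semidef_spectral:
  assumes "orthonormal_frame e"
  shows "pos_semidef (spectral e c) \<longleftrightarrow> (\<forall>i. 0 \<le> c i)"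
proof
  show "pos_semidef (spectral e c) \<Longrightarrow> \<forall>i. 0 \<le> c i"
    unfolding pos_semidef_def by (metis frame_quadratic_form[OF assms])
  show "\<forall>i. 0 \<le> c i \<Longrightarrow> pos_semidef (spectral e c)"
    by (simp add: pos_semidef_def symmetric_spectral spectral_quadratic_form sum_nonneg)
qed

lemma pos_def_spectralD:
  assumes "orthonormal_frame e" "pos_def (spectral e c)"
  shows "0 < c i"
  using assms by (metis frame_nonzero frame_quadratic_form pos_def_def)

lemma neg_def_spectralD:
  assumes "orthonormal_frame e" "neg_def (spectral e c)"
  shows "c i < 0"
  using assms by (metis frame_nonzero frame_quadratic_form neg_def_def)

lemma pos_def_imp_pos_semidef: "pos_def S \<Longrightarrow> pos_semidef S"
  unfolding pos_def_def pos_semidef_def by (metis inner_zero_left order_le_less)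

text \<open>
  The powers of \<open>spectral e c\<close> have coefficients \<open>c i ^ k\<close>, so the matrix series converges because
  the scalar exponential series does.
\<close>

lemma mat_exp_spectral:
  fixes e :: "'n::finite \<Rightarrow> real^'n"
  assumes "orthonormal_frame e"
  shows "mat_exp (spectral e c) = spectral e (\<lambda>i. exp (c i))"
proof -
  have pow: "((**) (spectral e c) ^^ k) (mat 1) = spectral e (\<lambda>i. c i ^ k)" for k
    by (induction k) (simp_all add: spectral_one[OF assms] spectral_mult[OF assms])
  have "(\<lambda>k. spectral e (\<lambda>i. c i ^ k /\<^sub>R fact k)) sums spectral e (\<lambda>i. exp (c i))"
    unfolding spectral_def by (intro sums_sum sums_scaleR_left exp_converges)
  then show ?thesis
    unfolding mat_exp_def pow scaleR_spectral
    by (simp add: sums_iff divide_inverse mult.commute)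
qed

lemma mat_exp_scaleR_spectral:
  fixes e :: "'n::finite \<Rightarrow> real^'n"
  assumes "orthonormal_frame e"
  shows "mat_exp (t *\<^sub>R spectral e c) = spectral e (\<lambda>i. exp (t * c i))"
  by (simp add: scaleR_spectral mat_exp_spectral[OF assms])

text \<open>
  The scalar version of \<open>K\<^sub>t\<close>, the integral of \<open>exp (s * c)\<close> over \<open>s\<close> from \<open>0\<close> to \<open>t\<close>.
\<close>

definition exp_primitive :: "real \<Rightarrow> real \<Rightarrow> real" where
  "exp_primitive t c = (if c = 0 then t else (exp (t * c) - 1) / c)"

lemma exp_primitive_zero [simp]: "exp_primitive 0 c = 0"
  by (simp add: exp_primitive_def)

lemma mult_exp_primitive: "c * exp_primitive t c + 1 = exp (t * c)"
  by (simp add: exp_primitive_def)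

lemma exp_primitive_derivative:
  "((\<lambda>t. exp_primitive t c) has_real_derivative exp (t * c)) (at t within J)"
proof (cases "c = 0")
  case True
  then show ?thesis by (auto simp: exp_primitive_def)
next
  case False
  have "((\<lambda>t. (exp (t * c) - 1) / c) has_real_derivative exp (t * c)) (at t within J)"
    using False by (auto intro!: derivative_eq_intros)
  with False show ?thesis by (simp add: exp_primitive_def)
qed

lemma exp_integral_spectral:
  fixes e :: "'n::finite \<Rightarrow> real^'n"
  assumes "orthonormal_frame e"
  shows "exp_integral t (spectral e c) = spectral e (\<lambda>i. exp_primitive t (c i))"
proof -
  have "(LBINT s=ereal 0..ereal t. spectral e (\<lambda>i. exp (s * c i)))
      = spectral e (\<lambda>i. exp_primitive t (c i)) - spectral e (\<lambda>i. exp_primitive 0 (c i))"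
  proof (rule interval_integral_FTC_finite)
    show "continuous_on {min 0 t..max 0 t} (\<lambda>s. spectral e (\<lambda>i. exp (s * c i)))"
      unfolding spectral_def by (intro continuous_intros)
  qed (intro spectral_has_vector_derivative exp_primitive_derivative)
  then show ?thesis
    by (simp add: exp_integral_def mat_exp_scaleR_spectral[OF assms] spectral_zero
        zero_ereal_def[symmetric])
qed

text \<open>
  Two pseudoinverses give the same projectors, \<open>A X = A Y\<close> and \<open>X A = Y A\<close>: each product is a product
  of the two symmetric projectors, and transposing it swaps them. Then
  \<open>X = X A X = X A Y = Y A Y = Y\<close>.
\<close>

lemma penrose_unique:
  fixes A X Y :: "real^'n^'n"
  assumes X: "A ** X ** A = A" "X ** A ** X = X" "symmetric_mat (A ** X)" "symmetric_mat (X ** A)"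
    and Y: "A ** Y ** A = A" "Y ** A ** Y = Y" "symmetric_mat (A ** Y)" "symmetric_mat (Y ** A)"
  shows "X = Y"
proof -
  have "A ** X = (A ** Y) ** (A ** X)" using Y(1) by (simp add: matrix_mul_assoc)
  then have "A ** X = transpose ((A ** Y) ** (A ** X))" using X(3) by (simp add: symmetric_mat_def)
  also have "\<dots> = (A ** X) ** (A ** Y)"
    using X(3) Y(3) by (simp add: matrix_transpose_mul[of "A ** Y"] symmetric_mat_def)
  also have "\<dots> = A ** Y" using X(1) by (simp add: matrix_mul_assoc)
  finally have AX: "A ** X = A ** Y" .
  have "X ** A = (X ** A) ** (Y ** A)" using Y(1) by (metis matrix_mul_assoc)
  then have "X ** A = transpose ((X ** A) ** (Y ** A))" using X(4) by (simp add: symmetric_mat_def)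
  also have "\<dots> = (Y ** A) ** (X ** A)"
    using X(4) Y(4) by (simp add: matrix_transpose_mul[of "X ** A"] symmetric_mat_def)
  also have "\<dots> = Y ** A" using X(1) by (metis matrix_mul_assoc)
  finally have XA: "X ** A = Y ** A" .
  show ?thesis by (metis AX XA X(2) Y(2) matrix_mul_assoc)
qed

text \<open>
  The convention \<open>inverse 0 = 0\<close> is exactly what the pseudoinverse does to the kernel.
\<close>

lemma pinv_spectral:
  fixes e :: "'n::finite \<Rightarrow> real^'n"
  assumes "orthonormal_frame e"
  shows "pinv (spectral e c) = spectral e (\<lambda>i. inverse (c i))"
proof -
  let ?A = "spectral e c" and ?X = "spectral e (\<lambda>i. inverse (c i))"
  let ?pen = "\<lambda>Y. ?A ** Y ** ?A = ?A \<and> Y ** ?A ** Y = Y \<and>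
      symmetric_mat (?A ** Y) \<and> symmetric_mat (Y ** ?A)"
  have cc: "x * inverse x * x = x" "inverse x * x * inverse x = inverse x" for x :: real
    by (cases "x = 0"; simp)+
  have pen: "?pen ?X"
    unfolding spectral_mult[OF assms] cc by (simp add: symmetric_spectral)
  have "Y = ?X" if "?pen Y" for Y
    by (rule penrose_unique[of ?A]) (use pen that in blast)+
  with pen show ?thesis unfolding pinv_def by (intro the_equality)
qed

lemma ker_proj_spectral:
  fixes e :: "'n::finite \<Rightarrow> real^'n"
  assumes "orthonormal_frame e"
  shows "ker_proj (spectral e c) = spectral e (\<lambda>i. if c i = 0 then 1 else 0)"
proof -
  have "(\<lambda>i. 1 - c i * inverse (c i)) = (\<lambda>i. if c i = 0 then 1 else 0)" by auto
  then show ?thesis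
    unfolding ker_proj_def pinv_spectral[OF assms] spectral_mult[OF assms]
      spectral_one[OF assms, symmetric] spectral_diff by (rule arg_cong)
qed

lemma matrix_inv_spectral:
  fixes e :: "'n::finite \<Rightarrow> real^'n"
  assumes "orthonormal_frame e" "\<And>i. c i \<noteq> 0"
  shows "matrix_inv (spectral e c) = spectral e (\<lambda>i. inverse (c i))"
proof -
  have inv: "spectral e c ** spectral e (\<lambda>i. inverse (c i)) = mat 1"
    "spectral e (\<lambda>i. inverse (c i)) ** spectral e c = mat 1"
    using assms(2) by (simp_all add: spectral_mult[OF assms(1)] spectral_one[OF assms(1)])
  then have "\<exists>B. spectral e c ** B = mat 1 \<and> B ** spectral e c = mat 1" by blast
  then have "spectral e c ** matrix_inv (spectral e c) = mat 1
      \<and> matrix_inv (spectral e c) ** spectral e c = mat 1"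
    unfolding matrix_inv_def by (rule someI_ex)
  with inv show ?thesis by (metis matrix_mul_assoc matrix_mul_lid matrix_mul_rid)
qed

lemma ker_proj_mult_eq_0_iff:
  fixes e :: "'n::finite \<Rightarrow> real^'n"
  assumes "orthonormal_frame e"
  shows "ker_proj (spectral e c) *v b = 0 \<longleftrightarrow> (\<forall>i. c i = 0 \<longrightarrow> e i \<bullet> b = 0)"
proof
  assume 0: "ker_proj (spectral e c) *v b = 0"
  have "(if c i = 0 then 1 else 0) * (e i \<bullet> b) = 0" for i
    using arg_cong[OF 0, of "\<lambda>x. e i \<bullet> x"]
    by (simp only: ker_proj_spectral[OF assms] inner_frame_spectral[OF assms] inner_zero_right)
  then show "\<forall>i. c i = 0 \<longrightarrow> e i \<bullet> b = 0" by (metis mult_1)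
qed (auto simp: ker_proj_spectral[OF assms] spectral_mult_vector intro!: sum.neutral)

section \<open>The positive semidefinite square root\<close>

text \<open>
  On an eigenvector \<open>v\<close> of \<open>R - T\<close> the difference of squares factorises,
  \<open>v \<bullet> (R\<^sup>2 - T\<^sup>2) v = (R v - T v) \<bullet> (R v + T v) = c (v \<bullet> R v + v \<bullet> T v)\<close>,
  and the second factor is at least \<open>\<bar>c\<bar>\<close> because \<open>c\<close> is the difference of its two nonnegative
  terms. This single estimate yields uniqueness of the square root and its Hoelder continuity with
  exponent one half.
\<close>

lemma psd_root_perturbation:
  fixes R T :: "real^'n^'n"
  assumes "pos_semidef R" "pos_semidef T"
    and v: "norm v = 1" "(R - T) *v v = c *\<^sub>R v"
  shows "c\<^sup>2 \<le> \<bar>v \<bullet> ((R ** R - T ** T) *v v)\<bar>"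
proof -
  define p q where "p = v \<bullet> (R *v v)" and "q = v \<bullet> (T *v v)"
  have sym: "symmetric_mat R" "symmetric_mat T" and nonneg: "0 \<le> p" "0 \<le> q"
    using assms by (auto simp: pos_semidef_def p_def q_def)
  have diff: "R *v v - T *v v = c *\<^sub>R v" using v by (simp add: matrix_vector_mult_diff_rdistrib)
  have "v \<bullet> ((R ** R - T ** T) *v v) = (R *v v) \<bullet> (R *v v) - (T *v v) \<bullet> (T *v v)"
    by (simp add: matrix_vector_mult_diff_rdistrib inner_diff_right
        symmetric_mat_inner[OF sym(1)] symmetric_mat_inner[OF sym(2)] matrix_vector_mul_assoc)
  also have "\<dots> = (R *v v - T *v v) \<bullet> (R *v v + T *v v)"
    by (simp add: inner_diff_left inner_add_right inner_commute[of "T *v v" "R *v v"])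
  also have "\<dots> = c * (p + q)" by (simp only: diff p_def q_def inner_add_right inner_scaleR_left distrib_left)
  finally have eq: "v \<bullet> ((R ** R - T ** T) *v v) = c * (p + q)" .
  have "c = p - q"
    using arg_cong[OF diff, of "\<lambda>u. v \<bullet> u"] v(1)
    by (simp add: p_def q_def inner_diff_right norm_eq_1)
  then have "\<bar>c\<bar> \<le> p + q" using nonneg by auto
  then have "\<bar>c\<bar> * \<bar>c\<bar> \<le> \<bar>c\<bar> * (p + q)" by (intro mult_left_mono) auto
  then show ?thesis using nonneg by (simp add: eq abs_mult power2_eq_square)
qed

lemma psd_root_unique:
  fixes R T :: "real^'n^'n"
  assumes R: "pos_semidef R" and T: "pos_semidef T" and eq: "R ** R = T ** T"
  shows "R = T"
proof -
  have "symmetric_mat (R - T)"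
    using R T unfolding pos_semidef_def by (blast intro: symmetric_mat_diff)
  then obtain e c where e: "orthonormal_frame e" "R - T = spectral e c"
    by (rule spectral_theorem)
  have "(c i)\<^sup>2 \<le> 0" for i
    using psd_root_perturbation[OF R T frame_norm[OF e(1)], of i "c i"]
    by (simp add: e(2) spectral_mult_frame[OF e(1)] eq)
  then have "c = (\<lambda>_. 0)" by auto
  then show ?thesis using e(2) by (simp add: spectral_zero)
qed

lemma psd_sqrt_eqI:
  assumes "pos_semidef R" "R ** R = S"
  shows "psd_sqrt S = R"
  unfolding psd_sqrt_def using assms psd_root_unique by (intro the_equality) auto

lemma psd_sqrt:
  fixes S :: "real^'n^'n"
  assumes "pos_semidef S"
  shows "pos_semidef (psd_sqrt S)" "psd_sqrt S ** psd_sqrt S = S"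
proof -
  obtain e c where e: "orthonormal_frame e" "S = spectral e c"
    using assms spectral_theorem pos_semidef_def by metis
  have c: "0 \<le> c i" for i using assms e by (simp add: pos_semidef_spectral)
  have R: "pos_semidef (spectral e (\<lambda>i. sqrt (c i)))"
      "spectral e (\<lambda>i. sqrt (c i)) ** spectral e (\<lambda>i. sqrt (c i)) = S"
    using e(1) c by (simp_all add: pos_semidef_spectral spectral_mult e(2))
  with psd_sqrt_eqI[OF R] show "pos_semidef (psd_sqrt S)" "psd_sqrt S ** psd_sqrt S = S"
    by simp_all
qed

lemma quadratic_form_le_entries:
  fixes M :: "real^'n^'n"
  assumes "norm v = 1"
  shows "\<bar>v \<bullet> (M *v v)\<bar> \<le> (\<Sum>i\<in>UNIV. \<Sum>j\<in>UNIV. \<bar>M $ i $ j\<bar>)"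
proof -
  have "\<bar>v \<bullet> (M *v v)\<bar> = \<bar>\<Sum>i\<in>UNIV. \<Sum>j\<in>UNIV. v $ i * (M $ i $ j * v $ j)\<bar>"
    by (simp add: inner_vec_def matrix_vector_mult_def sum_distrib_left)
  also have "\<dots> \<le> (\<Sum>i\<in>UNIV. \<Sum>j\<in>UNIV. \<bar>v $ i * (M $ i $ j * v $ j)\<bar>)"
    by (intro order_trans[OF sum_abs] sum_mono sum_abs)
  also have "\<dots> \<le> (\<Sum>i\<in>UNIV. \<Sum>j\<in>UNIV. \<bar>M $ i $ j\<bar>)"
  proof (intro sum_mono)
    fix i j
    have "\<bar>v $ i\<bar> \<le> 1" "\<bar>v $ j\<bar> \<le> 1"
      using component_le_norm_cart[of v] assms by metis+
    then have "\<bar>v $ i\<bar> * (\<bar>M $ i $ j\<bar> * \<bar>v $ j\<bar>) \<le> 1 * (\<bar>M $ i $ j\<bar> * 1)"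
      by (intro mult_mono) auto
    then show "\<bar>v $ i * (M $ i $ j * v $ j)\<bar> \<le> \<bar>M $ i $ j\<bar>" by (simp add: abs_mult)
  qed
  finally show ?thesis .
qed

text \<open>
  In absolute value, all eigenvalues of the difference of two roots are at most the square root of
  the entry sum norm of the difference of their squares, so the difference tends to zero although its eigenbasis may vary
  with \<open>t\<close>.
\<close>

lemma tendsto_psd_sqrt_mult_vector:
  fixes S :: "'t \<Rightarrow> real^'n^'n"
  assumes psd: "\<And>t. pos_semidef (S t)" "pos_semidef S'" and lim: "(S \<longlongrightarrow> S') F"
  shows "((\<lambda>t. psd_sqrt (S t) *v z) \<longlongrightarrow> psd_sqrt S' *v z) F"
proof -
  define g where "g t = (\<Sum>i\<in>UNIV. \<Sum>j\<in>UNIV. \<bar>(S t - S') $ i $ j\<bar>)" for t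
  have "(g \<longlongrightarrow> (\<Sum>i\<in>(UNIV::'n set). \<Sum>j\<in>(UNIV::'n set). \<bar>(S' - S') $ i $ j\<bar>)) F"
    unfolding g_def by (intro tendsto_intros lim)
  then have "(g \<longlongrightarrow> 0) F" by simp
  then have g0: "((\<lambda>t. CARD('n) * (sqrt (g t) * norm z)) \<longlongrightarrow> CARD('n) * (sqrt 0 * norm z)) F"
    by (intro tendsto_intros)
  have "norm (psd_sqrt (S t) *v z - psd_sqrt S' *v z) \<le> CARD('n) * (sqrt (g t) * norm z)" for t
  proof -
    let ?R = "psd_sqrt (S t)" and ?T = "psd_sqrt S'"
    note R = psd_sqrt[OF psd(1)[of t]] and T = psd_sqrt[OF psd(2)]
    have "symmetric_mat (?R - ?T)"
      using R(1) T(1) unfolding pos_semidef_def by (blast intro: symmetric_mat_diff)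
    then obtain e c where e: "orthonormal_frame e" "?R - ?T = spectral e c"
      by (rule spectral_theorem)
    have c: "\<bar>c i\<bar> \<le> sqrt (g t)" for i
    proof -
      have "(c i)\<^sup>2 \<le> \<bar>e i \<bullet> ((S t - S') *v e i)\<bar>"
        using psd_root_perturbation[OF R(1) T(1) frame_norm[OF e(1)], of i "c i"]
        by (simp add: e(2) spectral_mult_frame[OF e(1)] R(2) T(2))
      also have "\<dots> \<le> g t"
        unfolding g_def by (rule quadratic_form_le_entries) (rule frame_norm[OF e(1)])
      finally show ?thesis by (metis real_sqrt_abs real_sqrt_le_mono)
    qed
    have "norm (?R *v z - ?T *v z) = norm (\<Sum>i\<in>UNIV. (c i * (e i \<bullet> z)) *\<^sub>R e i)"
      by (simp add: matrix_vector_mult_diff_rdistrib[symmetric] e(2) spectral_mult_vector)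
    also have "\<dots> \<le> (\<Sum>i\<in>(UNIV::'n set). sqrt (g t) * norm z)"
    proof (rule sum_norm_le)
      fix i
      have "\<bar>e i \<bullet> z\<bar> \<le> norm z"
        using Cauchy_Schwarz_ineq2[of "e i" z] by (simp add: frame_norm[OF e(1)])
      then show "norm ((c i * (e i \<bullet> z)) *\<^sub>R e i) \<le> sqrt (g t) * norm z"
        using mult_mono[OF c[of i] \<open>\<bar>e i \<bullet> z\<bar> \<le> norm z\<close> order_trans[OF abs_ge_zero c[of i]] abs_ge_zero]
        by (simp only: abs_mult norm_scaleR frame_norm[OF e(1)] mult_1_right)
    qed
    finally show ?thesis by simp
  qed
  then have "\<forall>\<^sub>F t in F. norm (psd_sqrt (S t) *v z - psd_sqrt S' *v z) \<le> CARD('n) * (sqrt (g t) * norm z)"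
    by (intro always_eventually allI)
  moreover have "((\<lambda>t. CARD('n) * (sqrt (g t) * norm z)) \<longlongrightarrow> 0) F" using g0 by simp
  ultimately have "((\<lambda>t. psd_sqrt (S t) *v z - psd_sqrt S' *v z) \<longlongrightarrow> 0) F"
    by (rule Lim_null_comparison)
  then show ?thesis by (simp add: LIM_zero_iff)
qed

section \<open>The Lyapunov equation\<close>

text \<open>
  In an eigenbasis of \<open>S\<close> the entries of \<open>X S + S X\<close> are those of \<open>X\<close> multiplied by sums of two
  eigenvalues of \<open>S\<close>, which are positive.
\<close>

lemma lyapunov_injective:
  fixes S X :: "real^'n^'n"
  assumes "pos_def S" "X ** S + S ** X = 0"
  shows "X = 0"
proof -
  obtain e c where e: "orthonormal_frame e" "S = spectral e c"
    using assms(1) spectral_theorem pos_def_def by metis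
  have "e i \<bullet> (X *v e j) = 0" for i j
  proof -
    have "0 = e i \<bullet> ((X ** S + S ** X) *v e j)" by (simp add: assms(2))
    also have "\<dots> = (c j + c i) * (e i \<bullet> (X *v e j))"
      by (simp add: matrix_vector_mult_add_rdistrib matrix_vector_mul_assoc[symmetric]
          inner_add_right e(2) inner_frame_spectral[OF e(1)] spectral_mult_frame[OF e(1)]
          matrix_vector_mult_scaleR algebra_simps)
    finally show ?thesis
      using pos_def_spectralD[OF e(1), of c i] pos_def_spectralD[OF e(1), of c j] assms(1) e(2)
      by (smt (verit) mult_eq_0_iff)
  qed
  then have "X *v e j = 0" for j by (intro frame_vector_eqI[OF e(1)]) simp
  then show ?thesis by (intro frame_matrix_eqI[OF e(1)]) simp
qed

lemma lyapunov_solution_unique: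
  fixes S X Y :: "real^'n^'n"
  assumes S: "pos_def S" and eq: "X ** S + S ** X = Y ** S + S ** Y"
  shows "X = Y"
proof -
  have "(X - Y) ** S + S ** (X - Y) = (X ** S + S ** X) - (Y ** S + S ** Y)"
    by (simp add: vec_eq_iff matrix_matrix_mult_def sum.distrib[symmetric] sum_subtractf[symmetric]
        algebra_simps)
  also have "\<dots> = 0" by (simp only: eq diff_self)
  finally show ?thesis using lyapunov_injective[OF S] by (metis eq_iff_diff_eq_0)
qed

text \<open>
  An injective linear endomorphism of the finite-dimensional space of matrices is surjective. The
  solution is symmetric because its transpose solves the same equation.
\<close>

lemma lyapunov_unique_solution:
  fixes S M :: "real^'n^'n"
  assumes S: "pos_def S" and M: "symmetric_mat M"
  shows "\<exists>!X. symmetric_mat X \<and> X ** S + S ** X = M"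
proof -
  let ?L = "\<lambda>X. X ** S + S ** X"
  have inj: "X = Y" if "?L X = ?L Y" for X Y
    using S that by (rule lyapunov_solution_unique)
  have "linear ?L"
    by (intro linearI) (simp_all add: vec_eq_iff matrix_matrix_mult_def sum.distrib[symmetric]
        sum_distrib_left algebra_simps)
  moreover have "inj ?L" by (rule injI) (rule inj)
  ultimately have "surj ?L" by (rule linear_injective_imp_surjective) (rule refl)
  then obtain X where "M = ?L X" by (rule surjE)
  then have X: "?L X = M" by (rule sym)
  have S': "transpose S = S" using S by (simp add: pos_def_def symmetric_mat_def)
  have plus: "transpose (P + Q) = transpose P + transpose Q" for P Q :: "real^'n^'n"
    by (simp add: transpose_def vec_eq_iff)
  have "?L (transpose X) = transpose (?L X)"
    by (simp only: plus matrix_transpose_mul S' add.commute)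
  also have "\<dots> = ?L X" using M by (simp only: X symmetric_mat_def)
  finally have "symmetric_mat X" unfolding symmetric_mat_def by (rule inj)
  show ?thesis
  proof (rule ex1I)
    show "symmetric_mat X \<and> ?L X = M" using \<open>symmetric_mat X\<close> X ..
    show "Y = X" if "symmetric_mat Y \<and> ?L Y = M" for Y
      using trans[OF conjunct2[OF that] X[symmetric]] by (rule inj)
  qed
qed

lemma e1_representative_unique:
  fixes S :: "real^'n^'n"
  assumes "pos_def S" "symmetric_mat Sv"
  shows "\<exists>!p. case p of (A, b) \<Rightarrow> symmetric_mat A \<and> A ** S + S ** A = Sv \<and> A *v m + b = mv"
proof -
  from lyapunov_unique_solution[OF assms] obtain A
    where A: "symmetric_mat A" "A ** S + S ** A = Sv"
      and unique: "\<And>B. symmetric_mat B \<and> B ** S + S ** B = Sv \<Longrightarrow> B = A" by (metis (no_types))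
  show ?thesis
  proof (rule ex1I[of _ "(A, mv - A *v m)"])
    show "case (A, mv - A *v m) of (A, b) \<Rightarrow>
        symmetric_mat A \<and> A ** S + S ** A = Sv \<and> A *v m + b = mv"
      using A by simp
  next
    fix p
    assume p: "case p of (A, b) \<Rightarrow> symmetric_mat A \<and> A ** S + S ** A = Sv \<and> A *v m + b = mv"
    obtain B d where [simp]: "p = (B, d)" by (rule prod.exhaust)
    have "B = A" using p by (intro unique) simp
    moreover have "d = mv - B *v m" using p by (auto simp: algebra_simps)
    ultimately show "p = (A, mv - A *v m)" by simp
  qed
qed

section \<open>Fourier transform of Gaussian measures\<close>

lemma std_gaussian_density_Basis:
  fixes x :: "real^'n"
  shows "(\<Prod>i\<in>UNIV. std_normal_density (x $ i)) = (\<Prod>b\<in>Basis. std_normal_density (x \<bullet> b))"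
proof -
  have Basis: "(Basis :: (real^'n) set) = range (\<lambda>i. axis i 1)" by (auto simp: Basis_vec_def)
  have "inj (\<lambda>i. axis i (1::real) :: real^'n)" by (auto intro!: injI simp: axis_eq_axis)
  from prod.reindex[OF this, of "\<lambda>b. std_normal_density (x \<bullet> b)"]
  have "(\<Prod>b\<in>Basis. std_normal_density (x \<bullet> b))
      = (\<Prod>i\<in>UNIV. std_normal_density (x \<bullet> axis i 1))"
    unfolding Basis o_def .
  then show ?thesis by (simp add: inner_axis)
qed

lemma borel_measurable_std_gaussian_density:
  "(\<lambda>x::real^'n. \<Prod>i\<in>UNIV. std_normal_density (x $ i)) \<in> borel_measurable borel"
  unfolding std_gaussian_density_Basis by measurable

lemma sets_std_gaussian [simp, measurable_cong]: "sets std_gaussian = sets borel"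
  by (simp add: std_gaussian_def)

lemma space_std_gaussian [simp]: "space std_gaussian = UNIV"
  by (simp add: std_gaussian_def)

lemma measurable_std_gaussian [simp]: "measurable std_gaussian N = measurable borel N"
  by (rule measurable_cong_sets) simp_all

lemma prob_space_std_gaussian: "prob_space (std_gaussian :: (real^'n) measure)"
proof
  have [measurable]: "(\<lambda>x::real^'n. \<Prod>i\<in>UNIV. std_normal_density (x $ i)) \<in> borel_measurable borel"
    by (rule borel_measurable_std_gaussian_density)
  have one: "(\<integral>\<^sup>+y. ennreal (std_normal_density y) \<partial>lborel) = 1"
    using prob_space.emeasure_space_1[OF prob_space_normal_density[of 1 0]]
    by (simp add: emeasure_density)
  have "emeasure (std_gaussian :: (real^'n) measure) (space std_gaussian)
      = (\<integral>\<^sup>+x. ennreal (\<Prod>i\<in>UNIV. std_normal_density (x $ i)) \<partial>(lborel :: (real^'n) measure))"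
    by (simp add: std_gaussian_def emeasure_density)
  also have "\<dots> = (\<integral>\<^sup>+x. (\<Prod>b\<in>Basis. ennreal (std_normal_density (x \<bullet> b))) \<partial>(lborel :: (real^'n) measure))"
    unfolding std_gaussian_density_Basis by (simp add: prod_ennreal)
  also have "\<dots> = (\<Prod>b\<in>(Basis :: (real^'n) set). \<integral>\<^sup>+y. ennreal (std_normal_density y) \<partial>lborel)"
    by (rule nn_integral_lborel_prod) auto
  also have "\<dots> = 1" by (simp add: one)
  finally show "emeasure (std_gaussian :: (real^'n) measure) (space std_gaussian) = 1" .
qed

text \<open>
  Lebesgue measure on the Euclidean space is the image of a product measure and the integrand is a
  product over the coordinates, so the integral factorises into one-dimensional ones.
\<close>

lemma std_gaussian_characteristic_function:
  fixes \<eta> :: "real^'n"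
  shows "(\<integral>x. iexp (\<eta> \<bullet> x) \<partial>std_gaussian) = complex_of_real (exp (- (\<eta> \<bullet> \<eta>) / 2))"
proof -
  interpret P: product_sigma_finite "\<lambda>_::real^'n. lborel :: real measure" by standard
  have [measurable]: "(\<lambda>x::real^'n. \<Prod>i\<in>UNIV. std_normal_density (x $ i)) \<in> borel_measurable borel"
    by (rule borel_measurable_std_gaussian_density)
  define h where "h b y = std_normal_density y *\<^sub>R iexp ((\<eta> \<bullet> b) * y)" for b y
  have prod_h: "(\<Prod>i\<in>UNIV. std_normal_density (x $ i)) *\<^sub>R iexp (\<eta> \<bullet> x) = (\<Prod>b\<in>Basis. h b (x \<bullet> b))" for x
    unfolding std_gaussian_density_Basis h_def
    by (simp add: scaleR_conv_of_real prod.distrib euclidean_inner[of \<eta> x] exp_sum sum_distrib_left)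
  have int_h: "integrable lborel (h b)" for b
  proof -
    interpret N: prob_space std_normal_distribution by (rule prob_space_normal_density) simp
    have "integrable std_normal_distribution (\<lambda>y. iexp ((\<eta> \<bullet> b) * y))"
      by (rule N.integrable_const_bound[of _ 1]) auto
    then show ?thesis unfolding h_def by (subst (asm) integrable_density) auto
  qed
  have integral_h: "integral\<^sup>L lborel (h b) = complex_of_real (exp (- (\<eta> \<bullet> b)\<^sup>2 / 2))" for b
  proof -
    have "integral\<^sup>L lborel (h b) = char std_normal_distribution (\<eta> \<bullet> b)"
      unfolding char_def h_def by (subst integral_density) auto
    then show ?thesis by (simp add: char_std_normal_distribution)
  qed
  have "(\<integral>x. iexp (\<eta> \<bullet> x) \<partial>std_gaussian) = (\<integral>x. (\<Prod>b\<in>Basis. h b (x \<bullet> b)) \<partial>lborel)"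
    unfolding std_gaussian_def by (subst integral_density) (auto simp: prod_h prod_nonneg)
  also have "\<dots> = (\<integral>f. (\<Prod>b\<in>Basis. h b (f b)) \<partial>(\<Pi>\<^sub>M b\<in>(Basis :: (real^'n) set). lborel))"
    unfolding h_def by (subst lborel_eq, subst integral_distr) (auto intro!: Bochner_Integration.integral_cong)
  also have "\<dots> = (\<Prod>b\<in>Basis. complex_of_real (exp (- (\<eta> \<bullet> b)\<^sup>2 / 2)))"
    by (subst P.product_integral_prod) (auto simp: int_h integral_h)
  also have "\<dots> = complex_of_real (exp (- (\<eta> \<bullet> \<eta>) / 2))"
    by (simp add: euclidean_inner[of \<eta> \<eta>] exp_sum[symmetric] of_real_prod[symmetric] power2_eq_square
        sum_negf[symmetric] sum_divide_distrib del: of_real_prod)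
  finally show ?thesis .
qed

lemma measurable_affine:
  fixes M :: "real^'n^'n"
  shows "(\<lambda>z. m + M *v z) \<in> borel_measurable borel"
  by (intro borel_measurable_continuous_onI continuous_intros linear_continuous_on
      matrix_vector_mul_bounded_linear)

lemma integral_gaussian:
  fixes f :: "real^'n \<Rightarrow> 'b::{banach, second_countable_topology}"
  assumes "f \<in> borel_measurable borel"
  shows "integral\<^sup>L (gaussian m S) f = (\<integral>z. f (m + psd_sqrt S *v z) \<partial>std_gaussian)"
  unfolding gaussian_def using measurable_affine assms by (subst integral_distr) auto

text \<open>
  The real form of the characteristic function. The phase \<open>c\<close> makes the cosine alone carry the
  information of both the real and the imaginary part.
\<close>

lemma integral_cos_gaussian:
  fixes S :: "real^'n^'n"
  assumes "pos_semidef S"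
  shows "(\<integral>x. cos (\<xi> \<bullet> x + c) \<partial>gaussian m S) = cos (\<xi> \<bullet> m + c) * exp (- (\<xi> \<bullet> (S *v \<xi>)) / 2)"
proof -
  interpret prob_space "std_gaussian :: (real^'n) measure" by (rule prob_space_std_gaussian)
  let ?R = "psd_sqrt S"
  define \<eta> d where "\<eta> = ?R *v \<xi>" and "d = \<xi> \<bullet> m + c"
  have sym: "symmetric_mat ?R" using psd_sqrt(1)[OF assms] by (simp add: pos_semidef_def)
  have \<eta>: "\<eta> \<bullet> \<eta> = \<xi> \<bullet> (S *v \<xi>)"
    by (simp add: \<eta>_def symmetric_mat_inner[OF sym] matrix_vector_mul_assoc psd_sqrt(2)[OF assms])
  have int: "integrable std_gaussian (\<lambda>z::real^'n. iexp (\<eta> \<bullet> z))"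
    by (rule integrable_const_bound[of _ 1]) auto
  have cosRe: "cos (\<xi> \<bullet> (m + ?R *v z) + c) = Re (cis d * iexp (\<eta> \<bullet> z))" for z
  proof -
    have "\<xi> \<bullet> (m + ?R *v z) + c = d + \<eta> \<bullet> z"
      by (simp add: d_def \<eta>_def inner_add_right symmetric_mat_inner[OF sym])
    then show ?thesis by (simp add: cis_conv_exp[symmetric] cis_mult)
  qed
  have "(\<integral>x. cos (\<xi> \<bullet> x + c) \<partial>gaussian m S) = (\<integral>z. Re (cis d * iexp (\<eta> \<bullet> z)) \<partial>std_gaussian)"
    by (subst integral_gaussian) (auto simp: cosRe)
  also have "\<dots> = Re (\<integral>z. cis d * iexp (\<eta> \<bullet> z) \<partial>std_gaussian)"
    by (rule integral_Re) (intro integrable_mult_right int)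
  also have "\<dots> = Re (cis d * complex_of_real (exp (- (\<eta> \<bullet> \<eta>) / 2)))"
    by (simp only: integral_mult_right_zero std_gaussian_characteristic_function)
  also have "\<dots> = cos d * exp (- (\<eta> \<bullet> \<eta>) / 2)" by simp
  finally show ?thesis by (simp add: d_def \<eta>)
qed

text \<open>
  Combining two phases a quarter turn apart removes the mean and leaves the covariance.
\<close>

lemma exp_from_cos_transform:
  fixes a q :: real
  shows "(cos a * exp q)\<^sup>2 + (cos (a - pi / 2) * exp q)\<^sup>2 = (exp q)\<^sup>2"
proof -
  have "cos (a - pi / 2) = sin a" by (simp add: cos_diff)
  then have "(cos a * exp q)\<^sup>2 + (cos (a - pi / 2) * exp q)\<^sup>2 = ((sin a)\<^sup>2 + (cos a)\<^sup>2) * (exp q)\<^sup>2"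
    by (simp only: power_mult_distrib distrib_right add.commute)
  then show ?thesis by simp
qed

text \<open>
  The covariance is recovered from \<open>exp_from_cos_transform\<close>. For the means, a \<open>\<xi>\<close> along \<open>m - m'\<close>
  can be scaled so that the two phases differ by \<open>\<pi>\<close>, where the cosines have opposite signs.
\<close>

lemma gaussian_transform_injective:
  fixes m m' :: "real^'n" and S S' :: "real^'n^'n"
  assumes sym: "symmetric_mat S" "symmetric_mat S'"
    and eq: "\<And>\<xi> c. cos (\<xi> \<bullet> m + c) * exp (- (\<xi> \<bullet> (S *v \<xi>)) / 2)
                  = cos (\<xi> \<bullet> m' + c) * exp (- (\<xi> \<bullet> (S' *v \<xi>)) / 2)"
  shows "m = m'" "S = S'"
proof -
  have q: "\<xi> \<bullet> (S *v \<xi>) = \<xi> \<bullet> (S' *v \<xi>)" for \<xi>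
  proof -
    have "(exp (- (\<xi> \<bullet> (S *v \<xi>)) / 2))\<^sup>2 = (exp (- (\<xi> \<bullet> (S' *v \<xi>)) / 2))\<^sup>2"
      using exp_from_cos_transform[of "\<xi> \<bullet> m" "- (\<xi> \<bullet> (S *v \<xi>)) / 2"]
        exp_from_cos_transform[of "\<xi> \<bullet> m'" "- (\<xi> \<bullet> (S' *v \<xi>)) / 2"]
        eq[of \<xi> 0] eq[of \<xi> "- pi / 2"] by simp
    then show ?thesis by simp
  qed
  then show "S = S'" by (intro symmetric_mat_eqI sym)
  show "m = m'"
  proof (rule ccontr)
    assume "m \<noteq> m'"
    define w where "w = m - m'"
    have "w \<bullet> w \<noteq> 0" using \<open>m \<noteq> m'\<close> by (simp add: w_def)
    define \<xi> where "\<xi> = (pi / (w \<bullet> w)) *\<^sub>R w"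
    have "\<xi> \<bullet> m - \<xi> \<bullet> m' = \<xi> \<bullet> w" by (simp add: w_def inner_diff_right)
    also have "\<dots> = pi" using \<open>w \<bullet> w \<noteq> 0\<close> by (simp add: \<xi>_def)
    finally have "\<xi> \<bullet> m - \<xi> \<bullet> m' = pi" .
    moreover have "cos (\<xi> \<bullet> m - \<xi> \<bullet> m') = 1"
      using eq[of \<xi> "- (\<xi> \<bullet> m')"] q[of \<xi>] by simp
    ultimately show False by simp
  qed
qed

lemma gaussian_eq_imp:
  assumes "pos_semidef S" "pos_semidef S'" "gaussian m S = gaussian m' S'"
  shows "m = m'" "S = S'"
proof -
  have "cos (\<xi> \<bullet> m + c) * exp (- (\<xi> \<bullet> (S *v \<xi>)) / 2)
      = cos (\<xi> \<bullet> m' + c) * exp (- (\<xi> \<bullet> (S' *v \<xi>)) / 2)" for \<xi> c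
    using integral_cos_gaussian[OF assms(1), of m \<xi> c] integral_cos_gaussian[OF assms(2), of m' \<xi> c]
      assms(3) by simp
  then show "m = m'" "S = S'"
    using assms(1,2) gaussian_transform_injective[of S S' m m'] by (auto simp: pos_semidef_def)
qed

lemma gauss_chart_gaussian:
  assumes "pos_def S"
  shows "gauss_chart (gaussian m S) = (m, S)"
proof -
  have "inj_on (\<lambda>(m, S). gaussian m S) {(m :: real^'n, S). pos_def S}"
  proof (rule inj_onI, clarify)
    fix m m' :: "real^'n" and S S' :: "real^'n^'n"
    assume "pos_def S" "pos_def S'" "gaussian m S = gaussian m' S'"
    then show "m = m' \<and> S = S'"
      using gaussian_eq_imp[of S S' m m'] by (simp add: pos_def_imp_pos_semidef)
  qed
  from the_inv_into_f_f[OF this, of "(m, S)"] assms show ?thesis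
    by (simp add: gauss_chart_def)
qed

lemma gaussian_zero_covariance:
  fixes m :: "real^'n"
  shows "gaussian m 0 = return borel m"
proof -
  interpret prob_space "std_gaussian :: (real^'n) measure" by (rule prob_space_std_gaussian)
  have "psd_sqrt (0 :: real^'n^'n) = 0"
    by (rule psd_sqrt_eqI) (simp_all add: pos_semidef_def symmetric_mat_def transpose_def vec_eq_iff)
  then show ?thesis by (simp add: gaussian_def distr_const)
qed

section \<open>Weak limits of Gaussian measures\<close>

text \<open>
  All measures are images of one standard Gaussian under affine maps that converge pointwise, so
  dominated convergence applies to a bounded continuous test function.
\<close>

lemma gaussian_weak_limitI:
  fixes S :: "real \<Rightarrow> real^'n^'n"
  assumes psd: "\<And>t. pos_semidef (S t)" "pos_semidef S'"
    and lim: "(m \<longlongrightarrow> m') at_top" "(S \<longlongrightarrow> S') at_top"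
  shows "weak_limit (\<lambda>t. gaussian (m t) (S t)) (gaussian m' S') at_top"
  unfolding weak_limit_def
proof (intro allI impI)
  fix f :: "real^'n \<Rightarrow> real" assume f: "continuous_on UNIV f \<and> bounded (range f)"
  interpret prob_space "std_gaussian :: (real^'n) measure" by (rule prob_space_std_gaussian)
  have meas: "f \<in> borel_measurable borel" using f by (simp add: borel_measurable_continuous_onI)
  have meas': "(\<lambda>z. f (a + M *v z)) \<in> borel_measurable std_gaussian" for a and M :: "real^'n^'n"
    using measurable_compose[OF measurable_affine meas] by simp
  obtain C where C: "\<And>x. \<bar>f x\<bar> \<le> C" using f by (auto simp: bounded_iff)
  have lim_f: "((\<lambda>t. f (m t + psd_sqrt (S t) *v z)) \<longlongrightarrow> f (m' + psd_sqrt S' *v z)) at_top" for z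
  proof (rule isCont_tendsto_compose[where g = f])
    show "isCont f (m' + psd_sqrt S' *v z)" using f by (simp add: continuous_on_eq_continuous_at)
  qed (intro tendsto_add lim tendsto_psd_sqrt_mult_vector psd)
  have "((\<lambda>t. \<integral>z. f (m t + psd_sqrt (S t) *v z) \<partial>std_gaussian)
      \<longlongrightarrow> (\<integral>z. f (m' + psd_sqrt S' *v z) \<partial>std_gaussian)) at_top"
  proof (rule integral_dominated_convergence_at_top[where w = "\<lambda>_. C"])
    show "\<forall>\<^sub>F t in at_top. AE z in std_gaussian. norm (f (m t + psd_sqrt (S t) *v z)) \<le> C"
      using C by (intro always_eventually allI AE_I2) simp
  qed (intro meas' integrable_const AE_I2 lim_f)+
  then show "((\<lambda>t. integral\<^sup>L (gaussian (m t) (S t)) f) \<longlongrightarrow> integral\<^sup>L (gaussian m' S') f) at_top"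
    by (simp add: integral_gaussian[OF meas])
qed

lemma gaussian_weak_limit_transform:
  fixes S :: "'t \<Rightarrow> real^'n^'n"
  assumes "weak_limit (\<lambda>t. gaussian (m t) (S t)) (gaussian m' S') F"
    and "\<And>t. pos_semidef (S t)" "pos_semidef S'"
  shows "((\<lambda>t. cos (\<xi> \<bullet> m t + c) * exp (- (\<xi> \<bullet> (S t *v \<xi>)) / 2))
    \<longlongrightarrow> cos (\<xi> \<bullet> m' + c) * exp (- (\<xi> \<bullet> (S' *v \<xi>)) / 2)) F"
proof -
  have "continuous_on UNIV (\<lambda>x. cos (\<xi> \<bullet> x + c)) \<and> bounded (range (\<lambda>x. cos (\<xi> \<bullet> x + c)))"
    by (auto intro!: continuous_intros boundedI[of _ 1])
  with assms(1) have "((\<lambda>t. \<integral>x. cos (\<xi> \<bullet> x + c) \<partial>gaussian (m t) (S t))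
      \<longlongrightarrow> (\<integral>x. cos (\<xi> \<bullet> x + c) \<partial>gaussian m' S')) F"
    unfolding weak_limit_def by blast
  then show ?thesis by (simp add: integral_cos_gaussian assms(2,3))
qed

lemma gaussian_weak_limit_unique:
  fixes S :: "'t \<Rightarrow> real^'n^'n"
  assumes "F \<noteq> bot" "\<And>t. pos_semidef (S t)" "pos_semidef S1" "pos_semidef S2"
    and "weak_limit (\<lambda>t. gaussian (m t) (S t)) (gaussian m1 S1) F"
    and "weak_limit (\<lambda>t. gaussian (m t) (S t)) (gaussian m2 S2) F"
  shows "m1 = m2" "S1 = S2"
proof -
  have "cos (\<xi> \<bullet> m1 + c) * exp (- (\<xi> \<bullet> (S1 *v \<xi>)) / 2)
      = cos (\<xi> \<bullet> m2 + c) * exp (- (\<xi> \<bullet> (S2 *v \<xi>)) / 2)" for \<xi> c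
    using tendsto_unique[OF assms(1) gaussian_weak_limit_transform[OF assms(5,2,3)]
        gaussian_weak_limit_transform[OF assms(6,2,4)]] .
  then show "m1 = m2" "S1 = S2"
    using assms(3,4) gaussian_transform_injective[of S1 S2 m1 m2] by (auto simp: pos_semidef_def)
qed

text \<open>
  If the variance in direction \<open>\<xi>\<close> grew without bound, the transform at \<open>\<xi>\<close> would tend to \<open>0\<close> for
  every phase, but for the phase \<open>- (\<xi> \<bullet> m')\<close> the limit measure has a positive transform.
\<close>

lemma gaussian_weak_limit_variance:
  fixes S :: "'t \<Rightarrow> real^'n^'n"
  assumes "weak_limit (\<lambda>t. gaussian (m t) (S t)) (gaussian m' S') F" "F \<noteq> bot"
    and "\<And>t. pos_semidef (S t)" "pos_semidef S'"
  shows "\<not> filterlim (\<lambda>t. \<xi> \<bullet> (S t *v \<xi>)) at_top F"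
proof
  assume top: "filterlim (\<lambda>t. \<xi> \<bullet> (S t *v \<xi>)) at_top F"
  have zero: "((\<lambda>t. exp (- (\<xi> \<bullet> (S t *v \<xi>)) / 2)) \<longlongrightarrow> 0) F"
  proof -
    have "filterlim (\<lambda>t. 1 / 2 * (\<xi> \<bullet> (S t *v \<xi>))) at_top F"
      by (rule filterlim_tendsto_pos_mult_at_top[OF tendsto_const _ top]) simp
    then have "filterlim (\<lambda>t. - (\<xi> \<bullet> (S t *v \<xi>)) / 2) at_bot F"
      by (simp add: filterlim_uminus_at_top)
    then show ?thesis by (rule filterlim_compose[OF exp_at_bot])
  qed
  have "((\<lambda>t. cos (\<xi> \<bullet> m t - \<xi> \<bullet> m') * exp (- (\<xi> \<bullet> (S t *v \<xi>)) / 2)) \<longlongrightarrow> 0) F"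
  proof (rule Lim_null_comparison[OF always_eventually zero], rule allI)
    fix t
    show "norm (cos (\<xi> \<bullet> m t - \<xi> \<bullet> m') * exp (- (\<xi> \<bullet> (S t *v \<xi>)) / 2)) \<le> exp (- (\<xi> \<bullet> (S t *v \<xi>)) / 2)"
      by (simp add: abs_mult mult_le_cancel_right1)
  qed
  moreover have "((\<lambda>t. cos (\<xi> \<bullet> m t - \<xi> \<bullet> m') * exp (- (\<xi> \<bullet> (S t *v \<xi>)) / 2))
      \<longlongrightarrow> exp (- (\<xi> \<bullet> (S' *v \<xi>)) / 2)) F"
    using gaussian_weak_limit_transform[OF assms(1,3,4), of \<xi> "- (\<xi> \<bullet> m')"] by simp
  ultimately have "0 = exp (- (\<xi> \<bullet> (S' *v \<xi>)) / 2)"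
    by (rule tendsto_unique[OF assms(2)])
  then show False by simp
qed

text \<open>
  With constant variance and a mean that moves at speed \<open>\<beta> \<noteq> 0\<close>, the transform at a suitable multiple
  of \<open>\<xi>\<close> changes sign after each unit of time. A limit would have to be \<open>0\<close> for every phase, which
  again fails for the phase that is adapted to the limit mean.
\<close>

lemma gaussian_weak_limit_no_drift:
  fixes S :: "real \<Rightarrow> real^'n^'n"
  assumes lim: "weak_limit (\<lambda>t. gaussian (m t) (S t)) (gaussian m' S') at_top"
    and psd: "\<And>t. pos_semidef (S t)" "pos_semidef S'"
    and drift: "\<And>t. \<xi> \<bullet> m t = a + t * \<beta>" and const: "\<And>t. \<xi> \<bullet> (S t *v \<xi>) = q"
  shows "\<beta> = 0"
proof (rule ccontr)
  assume "\<beta> \<noteq> 0"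
  \<comment> \<open>Scaled so that the mean advances by half a period of the cosine in one unit of time.\<close>
  define \<zeta> where "\<zeta> = (pi / \<beta>) *\<^sub>R \<xi>"
  define c where "c = - (\<zeta> \<bullet> m')"
  define X where "X t = cos (\<zeta> \<bullet> m t + c) * exp (- (\<zeta> \<bullet> (S t *v \<zeta>)) / 2)" for t
  define L where "L = cos (\<zeta> \<bullet> m' + c) * exp (- (\<zeta> \<bullet> (S' *v \<zeta>)) / 2)"
  have X: "(X \<longlongrightarrow> L) at_top"
    unfolding X_def L_def by (rule gaussian_weak_limit_transform[OF lim psd])
  have "\<zeta> \<bullet> m (1 + t) = \<zeta> \<bullet> m t + pi" for t
    using \<open>\<beta> \<noteq> 0\<close> by (simp add: \<zeta>_def drift field_simps)
  moreover have "\<zeta> \<bullet> (S t *v \<zeta>) = (pi / \<beta>)\<^sup>2 * q" for t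
    by (simp add: \<zeta>_def matrix_vector_mult_scaleR const power2_eq_square)
  moreover have "cos (\<zeta> \<bullet> m t + pi + c) = - cos (\<zeta> \<bullet> m t + c)" for t
    using cos_periodic_pi[of "\<zeta> \<bullet> m t + c"] by (simp add: add_ac)
  ultimately have "X (1 + t) = - X t" for t
    by (simp only: X_def mult_minus_left)
  moreover have "((\<lambda>t. X (1 + t)) \<longlongrightarrow> L) at_top"
    by (rule filterlim_compose[OF X filterlim_tendsto_add_at_top[OF tendsto_const filterlim_ident]])
  ultimately have "((\<lambda>t. - X t) \<longlongrightarrow> L) at_top" by simp
  moreover have "((\<lambda>t. - X t) \<longlongrightarrow> - L) at_top" using X by (rule tendsto_minus)
  ultimately have "L = - L" by (intro tendsto_unique[OF trivial_limit_at_top_linorder])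
  then show False by (simp add: L_def c_def)
qed

section \<open>Geodesics in the global chart\<close>

lemma otto_rep_eqI:
  assumes S: "pos_def S" and A: "symmetric_mat A" "A ** S + S ** A = Sv" "A *v m + b = mv"
  shows "otto_rep (gaussian m S) (mv, Sv) = (A, b)"
proof -
  have "(THE p. case p of (A, b) \<Rightarrow> symmetric_mat A \<and> A ** S + S ** A = Sv \<and> A *v m + b = mv) = (A, b)"
  proof (rule the_equality)
    show "case (A, b) of (A, b) \<Rightarrow> symmetric_mat A \<and> A ** S + S ** A = Sv \<and> A *v m + b = mv"
      using A by blast
  next
    fix p
    assume p: "case p of (A, b) \<Rightarrow> symmetric_mat A \<and> A ** S + S ** A = Sv \<and> A *v m + b = mv"
    obtain B d where [simp]: "p = (B, d)" by (rule prod.exhaust)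
    have "B = A" using p A(2) lyapunov_solution_unique[OF S, of B A] by simp
    moreover have "B *v m + d = A *v m + b" using p A(3) by simp
    ultimately show "p = (A, b)" by simp
  qed
  then show ?thesis by (simp add: otto_rep_def gauss_chart_gaussian[OF S])
qed

lemma e1_transport_eqI:
  assumes "pos_def S" "pos_def S'" "symmetric_mat A" "A ** S + S ** A = Sv" "A *v m + b = mv"
  shows "e1_transport (gaussian m S) (gaussian m' S') (mv, Sv) = (A *v m' + b, A ** S' + S' ** A)"
  using otto_rep_eqI[OF assms(1,3-5)] gauss_chart_gaussian[OF assms(2), of m']
  by (simp add: e1_transport_def)

text \<open>
  Together with \<open>e1_geodesic_fromD\<close> this translates geodesics into the linear system for the mean and
  the covariance, with the constant pair \<open>(A, b)\<close> of the initial velocity.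
\<close>

lemma e1_geodesic_fromI:
  fixes A :: "real^'n^'n"
  assumes J: "is_interval J" "0 \<in> J" "J \<noteq> {0}"
    and S: "\<And>t. pos_def (S t)"
    and A: "symmetric_mat A" "A ** S 0 + S 0 ** A = Sa" "A *v m 0 + b = ma"
    and deriv: "\<And>t. t \<in> J \<Longrightarrow> (m has_vector_derivative A *v m t + b) (at t within J)"
      "\<And>t. t \<in> J \<Longrightarrow> (S has_vector_derivative A ** S t + S t ** A) (at t within J)"
  shows "e1_geodesic_from (gaussian (m 0) (S 0)) (ma, Sa) J (\<lambda>t. gaussian (m t) (S t))"
proof -
  let ?\<gamma> = "\<lambda>t. gaussian (m t) (S t)"
  have vel: "has_gauss_velocity ?\<gamma> J t (A *v m t + b, A ** S t + S t ** A)" if "t \<in> J" for t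
    unfolding has_gauss_velocity_def gauss_chart_gaussian[OF S]
    by (rule has_vector_derivative_Pair[OF deriv[OF that]])
  have transport: "e1_transport (?\<gamma> 0) (?\<gamma> t) (ma, Sa) = (A *v m t + b, A ** S t + S t ** A)" for t
    by (rule e1_transport_eqI[OF S S A])
  have "has_gauss_velocity ?\<gamma> J 0 (ma, Sa)" using vel[OF J(2)] by (simp only: A)
  moreover have "?\<gamma> t \<in> nondeg_gaussians" for t
    using S unfolding nondeg_gaussians_def by blast
  ultimately show ?thesis
    unfolding e1_geodesic_from_def e1_geodesic_on_def using J vel
    by (intro conjI exI[of _ "(ma, Sa)"] ballI) (simp_all only: transport not_False_eq_True)
qed

lemma e1_geodesic_fromD:
  fixes A :: "real^'n^'n"
  assumes geo: "e1_geodesic_from (gaussian m0 S0) (ma, Sa) J \<delta>" and S0: "pos_def S0"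
    and A: "symmetric_mat A" "A ** S0 + S0 ** A = Sa" "A *v m0 + b = ma"
  obtains m S where "\<And>t. t \<in> J \<Longrightarrow> \<delta> t = gaussian (m t) (S t)" "m 0 = m0" "S 0 = S0"
    "\<And>t. t \<in> J \<Longrightarrow> (m has_vector_derivative A *v m t + b) (at t within J)"
    "\<And>t. t \<in> J \<Longrightarrow> (S has_vector_derivative A ** S t + S t ** A) (at t within J)"
proof -
  define m where "m t = fst (gauss_chart (\<delta> t))" for t
  define S where "S t = snd (gauss_chart (\<delta> t))" for t
  from geo have J: "is_interval J" "0 \<in> J" "J \<noteq> {0}" and \<delta>0: "\<delta> 0 = gaussian m0 S0"
    and nondeg: "\<And>t. t \<in> J \<Longrightarrow> \<delta> t \<in> nondeg_gaussians"
    and vel0: "has_gauss_velocity \<delta> J 0 (ma, Sa)"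
    by (auto simp: e1_geodesic_from_def e1_geodesic_on_def)
  from geo obtain v where v: "has_gauss_velocity \<delta> J 0 v"
      "\<And>t. t \<in> J \<Longrightarrow> has_gauss_velocity \<delta> J t (e1_transport (\<delta> 0) (\<delta> t) v)"
    unfolding e1_geodesic_from_def e1_geodesic_on_def by blast
  \<comment> \<open>As \<open>0\<close> is not isolated in \<open>J\<close>, the velocity at time \<open>0\<close> is unique, so the geodesic equation
    holds for the prescribed one.\<close>
  have "0 islimpt J"
    using J by (intro connected_imp_perfect) (auto simp: is_interval_connected_1)
  then have "at 0 within J \<noteq> bot" by (simp add: trivial_limit_within)
  then have v_eq: "v = (ma, Sa)"
    using v(1) vel0 unfolding has_gauss_velocity_def by (rule vector_derivative_unique_within)
  have coords: "\<delta> t = gaussian (m t) (S t)" "pos_def (S t)" if t: "t \<in> J" for t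
  proof -
    obtain m' S' where "\<delta> t = gaussian m' S'" "pos_def S'"
      using nondeg[OF t] by (auto simp: nondeg_gaussians_def)
    then show "\<delta> t = gaussian (m t) (S t)" "pos_def (S t)"
      by (simp_all add: m_def S_def gauss_chart_gaussian)
  qed
  have "((\<lambda>s. gauss_chart (\<delta> s)) has_vector_derivative (A *v m t + b, A ** S t + S t ** A)) (at t within J)"
    if t: "t \<in> J" for t
  proof -
    have "e1_transport (\<delta> 0) (\<delta> t) v = (A *v m t + b, A ** S t + S t ** A)"
      unfolding \<delta>0 v_eq coords(1)[OF t] by (rule e1_transport_eqI[OF S0 coords(2)[OF t] A])
    with v(2)[OF t] show ?thesis by (simp add: has_gauss_velocity_def)
  qed
  from bounded_linear.has_vector_derivative[OF bounded_linear_fst this]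
    bounded_linear.has_vector_derivative[OF bounded_linear_snd this]
  have "(m has_vector_derivative A *v m t + b) (at t within J)"
    "(S has_vector_derivative A ** S t + S t ** A) (at t within J)" if "t \<in> J" for t
    using that by (simp_all add: m_def[abs_def] S_def[abs_def])
  moreover have "m 0 = m0" "S 0 = S0"
    by (simp_all add: m_def S_def \<delta>0 gauss_chart_gaussian[OF S0])
  ultimately show thesis using that coords(1) by blast
qed

text \<open>
  The integrating factor \<open>exp (- (c * t))\<close> turns a solution into a constant. Derivatives are taken
  within \<open>J\<close>, so the endpoints of \<open>J\<close> are covered as well.
\<close>

lemma linear_ode_zero:
  fixes x :: "real \<Rightarrow> real"
  assumes "is_interval J" "0 \<in> J" "x 0 = 0" "t \<in> J"
    and deriv: "\<And>t. t \<in> J \<Longrightarrow> (x has_real_derivative c * x t) (at t within J)"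
  shows "x t = 0"
proof -
  have "((\<lambda>t. exp (- (c * t)) * x t) has_real_derivative 0) (at t within J)" if "t \<in> J" for t
    using deriv[OF that] by (auto intro!: derivative_eq_intros simp: algebra_simps)
  then obtain k where k: "\<And>t. t \<in> J \<Longrightarrow> exp (- (c * t)) * x t = k"
    using has_field_derivative_zero_constant[of J "\<lambda>t. exp (- (c * t)) * x t"] assms(1)
    by (auto simp: is_interval_convex_1)
  from k[OF assms(2)] k[OF assms(4)] assms(3) show ?thesis by simp
qed

text \<open>
  In an eigenbasis of \<open>A\<close> the coordinates of the difference of two solutions decouple. The same holds
  for the entries in \<open>lyapunov_ode_unique\<close>, with rate the sum of two eigenvalues.
\<close>

lemma affine_vector_ode_unique:
  fixes A :: "real^'n^'n"
  assumes A: "symmetric_mat A" and J: "is_interval J" "0 \<in> J" "t \<in> J" and "m 0 = m' 0"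
    and deriv: "\<And>t. t \<in> J \<Longrightarrow> (m has_vector_derivative A *v m t + b) (at t within J)"
      "\<And>t. t \<in> J \<Longrightarrow> (m' has_vector_derivative A *v m' t + b) (at t within J)"
  shows "m t = m' t"
proof -
  obtain e c where e: "orthonormal_frame e" "A = spectral e c"
    using A by (rule spectral_theorem)
  have "e i \<bullet> (m t - m' t) = 0" for i
  proof (rule linear_ode_zero[OF J(1,2) _ J(3), of "\<lambda>t. e i \<bullet> (m t - m' t)" "c i"])
    fix t assume t: "t \<in> J"
    from bounded_linear.has_vector_derivative[OF bounded_linear_inner_right[of "e i"]
        has_vector_derivative_diff[OF deriv[OF t]]]
    show "((\<lambda>t. e i \<bullet> (m t - m' t)) has_real_derivative c i * (e i \<bullet> (m t - m' t))) (at t within J)"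
      by (simp add: has_real_derivative_iff_has_vector_derivative e(2) inner_diff_right
          inner_add_right inner_frame_spectral[OF e(1)] right_diff_distrib)
  qed (simp add: assms)
  then show ?thesis by (intro frame_vector_eqI[OF e(1)]) (simp add: inner_diff_right)
qed

lemma lyapunov_ode_unique:
  fixes A :: "real^'n^'n"
  assumes A: "symmetric_mat A" and J: "is_interval J" "0 \<in> J" "t \<in> J" and "S 0 = S' 0"
    and deriv: "\<And>t. t \<in> J \<Longrightarrow> (S has_vector_derivative A ** S t + S t ** A) (at t within J)"
      "\<And>t. t \<in> J \<Longrightarrow> (S' has_vector_derivative A ** S' t + S' t ** A) (at t within J)"
  shows "S t = S' t"
proof -
  obtain e c where e: "orthonormal_frame e" "A = spectral e c"
    using A by (rule spectral_theorem)
  have entry: "e i \<bullet> ((A ** M + M ** A) *v e j) = (c i + c j) * (e i \<bullet> (M *v e j))" for M i j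
    by (simp add: matrix_vector_mult_add_rdistrib matrix_vector_mul_assoc[symmetric] e(2)
        inner_add_right inner_frame_spectral[OF e(1)] spectral_mult_frame[OF e(1)]
        matrix_vector_mult_scaleR distrib_right)
  have "e i \<bullet> (S t *v e j) - e i \<bullet> (S' t *v e j) = 0" for i j
  proof (rule linear_ode_zero[OF J(1,2) _ J(3),
        of "\<lambda>t. e i \<bullet> (S t *v e j) - e i \<bullet> (S' t *v e j)" "c i + c j"])
    fix t assume t: "t \<in> J"
    note entry_deriv = bounded_linear.has_vector_derivative[OF bounded_linear_inner_right[of "e i"]
        bounded_linear.has_vector_derivative[OF bounded_linear_mult_vector[of "e j"]]]
    from has_vector_derivative_diff[OF entry_deriv[OF deriv(1)[OF t]] entry_deriv[OF deriv(2)[OF t]]]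
    show "((\<lambda>t. e i \<bullet> (S t *v e j) - e i \<bullet> (S' t *v e j)) has_real_derivative
        (c i + c j) * (e i \<bullet> (S t *v e j) - e i \<bullet> (S' t *v e j))) (at t within J)"
      unfolding entry by (simp only: has_real_derivative_iff_has_vector_derivative right_diff_distrib)
  qed (simp add: assms)
  then have "S t *v e j = S' t *v e j" for j
    by (intro frame_vector_eqI[OF e(1)]) simp
  then show ?thesis by (rule frame_matrix_eqI[OF e(1)])
qed

definition geodesic_mean :: "real^'n \<Rightarrow> real^'n^'n \<Rightarrow> real^'n \<Rightarrow> real \<Rightarrow> real^'n" where
  "geodesic_mean m0 A b t = mat_exp (t *\<^sub>R A) *v m0 + exp_integral t A *v b"

definition geodesic_cov :: "real^'n^'n \<Rightarrow> real^'n^'n \<Rightarrow> real \<Rightarrow> real^'n^'n" where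
  "geodesic_cov S0 A t = mat_exp (t *\<^sub>R A) ** S0 ** mat_exp (t *\<^sub>R A)"

text \<open>
  The matrix \<open>A\<close> is \<open>spectral e c\<close> here, so both components of the curve are given by scalar
  functions of its eigenvalues \<open>c i\<close>.
\<close>

context
  fixes e :: "'n::finite \<Rightarrow> real^'n" and c :: "'n \<Rightarrow> real"
  assumes frame: "orthonormal_frame e"
begin

lemma geodesic_mean_spectral:
  "geodesic_mean m0 (spectral e c) b t =
    spectral e (\<lambda>i. exp (t * c i)) *v m0 + spectral e (\<lambda>i. exp_primitive t (c i)) *v b"
  by (simp add: geodesic_mean_def mat_exp_scaleR_spectral[OF frame] exp_integral_spectral[OF frame])

lemma geodesic_cov_spectral:
  "geodesic_cov S0 (spectral e c) t = spectral e (\<lambda>i. exp (t * c i)) ** S0 ** spectral e (\<lambda>i. exp (t * c i))"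
  by (simp add: geodesic_cov_def mat_exp_scaleR_spectral[OF frame])

lemma exp_spectral_derivative:
  "((\<lambda>t. spectral e (\<lambda>i. exp (t * c i))) has_vector_derivative spectral e (\<lambda>i. c i * exp (t * c i)))
    (at t within J)"
  by (rule spectral_has_vector_derivative) (auto intro!: derivative_eq_intros)

lemma geodesic_mean_derivative:
  "(geodesic_mean m0 (spectral e c) b has_vector_derivative
      spectral e c *v geodesic_mean m0 (spectral e c) b t + b) (at t within J)"
proof -
  let ?A = "spectral e c"
  have "((\<lambda>t. spectral e (\<lambda>i. exp (t * c i)) *v m0 + spectral e (\<lambda>i. exp_primitive t (c i)) *v b)
      has_vector_derivative spectral e (\<lambda>i. c i * exp (t * c i)) *v m0 + spectral e (\<lambda>i. exp (t * c i)) *v b)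
      (at t within J)"
    by (intro has_vector_derivative_add bounded_linear.has_vector_derivative[OF bounded_linear_mult_vector]
        exp_spectral_derivative spectral_has_vector_derivative exp_primitive_derivative)
  moreover have "spectral e (\<lambda>i. c i * exp (t * c i)) *v m0 + spectral e (\<lambda>i. exp (t * c i)) *v b
      = ?A *v geodesic_mean m0 ?A b t + b"
    by (rule frame_vector_eqI[OF frame])
      (simp add: geodesic_mean_spectral inner_add_right inner_frame_spectral[OF frame]
        mult_exp_primitive[symmetric] algebra_simps)
  ultimately show ?thesis by (simp add: geodesic_mean_spectral[abs_def])
qed

lemma geodesic_cov_derivative:
  "(geodesic_cov S0 (spectral e c) has_vector_derivative
      spectral e c ** geodesic_cov S0 (spectral e c) t + geodesic_cov S0 (spectral e c) t ** spectral e c)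
    (at t within J)"
proof -
  let ?A = "spectral e c" and ?E = "\<lambda>t. spectral e (\<lambda>i. exp (t * c i))"
  let ?E' = "spectral e (\<lambda>i. c i * exp (t * c i))"
  note mult = bounded_bilinear.has_vector_derivative[OF bounded_bilinear_matrix_mult]
  have "((\<lambda>t. ?E t ** S0 ** ?E t) has_vector_derivative
      (?E t ** S0) ** ?E' + (?E t ** 0 + ?E' ** S0) ** ?E t) (at t within J)"
    by (intro mult exp_spectral_derivative has_vector_derivative_const)
  moreover have "(?E t ** S0) ** ?E' = geodesic_cov S0 ?A t ** ?A"
  proof -
    have "?E' = ?E t ** ?A" by (simp add: spectral_mult[OF frame] mult.commute)
    then show ?thesis by (simp only: geodesic_cov_spectral matrix_mul_assoc)
  qed
  moreover have "(?E t ** 0 + ?E' ** S0) ** ?E t = ?A ** geodesic_cov S0 ?A t"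
  proof -
    have "?E t ** (0 :: real^'n^'n) = 0" by (simp add: vec_eq_iff matrix_matrix_mult_def)
    moreover have "?E' = ?A ** ?E t" by (simp add: spectral_mult[OF frame])
    ultimately show ?thesis by (simp only: geodesic_cov_spectral matrix_mul_assoc add_0_left)
  qed
  ultimately show ?thesis by (simp only: geodesic_cov_spectral[abs_def] add.commute)
qed

end

text \<open>
  The exponential has positive eigenvalues, hence trivial kernel, and a congruence by an injective
  symmetric matrix preserves positive definiteness.
\<close>

lemma pos_def_geodesic_cov:
  fixes A S0 :: "real^'n^'n"
  assumes "symmetric_mat A" "pos_def S0"
  shows "pos_def (geodesic_cov S0 A t)"
proof -
  obtain e c where e: "orthonormal_frame e" "A = spectral e c"
    using assms(1) by (rule spectral_theorem)
  let ?E = "spectral e (\<lambda>i. exp (t * c i))"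
  have "?E *v x \<noteq> 0" if "x \<noteq> 0" for x
  proof
    assume 0: "?E *v x = 0"
    have "e i \<bullet> x = 0" for i
      using inner_frame_spectral[OF e(1), of i "\<lambda>i. exp (t * c i)" x] by (simp add: 0)
    then have "x = 0" by (intro frame_vector_eqI[OF e(1)]) simp
    with that show False by simp
  qed
  then show ?thesis
    using assms(2) unfolding e(2) geodesic_cov_spectral[OF e(1)] pos_def_def
    by (simp add: symmetric_congruence symmetric_spectral congruence_quadratic_form)
qed

lemma geodesic_initial:
  assumes "symmetric_mat A"
  shows "geodesic_mean m0 A b 0 = m0" "geodesic_cov S0 A 0 = S0"
proof -
  obtain e c where e: "orthonormal_frame e" "A = spectral e c"
    using assms by (rule spectral_theorem)
  show "geodesic_mean m0 A b 0 = m0" "geodesic_cov S0 A 0 = S0"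
    by (simp_all add: e(2) geodesic_mean_spectral[OF e(1)] geodesic_cov_spectral[OF e(1)]
        spectral_one[OF e(1)] spectral_zero)
qed

lemma e1_geodesic_exists:
  fixes A S0 :: "real^'n^'n"
  assumes S0: "pos_def S0" and A: "symmetric_mat A" "A ** S0 + S0 ** A = Sa" "A *v m0 + b = ma"
  shows "e1_geodesic_from (gaussian m0 S0) (ma, Sa) UNIV
    (\<lambda>t. gaussian (geodesic_mean m0 A b t) (geodesic_cov S0 A t))"
proof -
  obtain e c where e: "orthonormal_frame e" "A = spectral e c"
    using A(1) by (rule spectral_theorem)
  have "(1::real) \<in> UNIV - {0}" by simp
  then have "(UNIV :: real set) \<noteq> {0}" by blast
  moreover have "(geodesic_mean m0 A b has_vector_derivative A *v geodesic_mean m0 A b t + b) (at t within UNIV)"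
    "(geodesic_cov S0 A has_vector_derivative
        A ** geodesic_cov S0 A t + geodesic_cov S0 A t ** A) (at t within UNIV)" for t
    unfolding e(2) by (rule geodesic_mean_derivative[OF e(1)] geodesic_cov_derivative[OF e(1)])+
  ultimately show ?thesis
    using e1_geodesic_fromI[of UNIV "geodesic_cov S0 A" A Sa "geodesic_mean m0 A b" b ma]
      A pos_def_geodesic_cov[OF A(1) S0]
    by (simp add: geodesic_initial[OF A(1)] is_interval_univ)
qed

lemma e1_geodesic_unique:
  fixes A S0 :: "real^'n^'n"
  assumes S0: "pos_def S0" and A: "symmetric_mat A" "A ** S0 + S0 ** A = Sa" "A *v m0 + b = ma"
    and geo: "e1_geodesic_from (gaussian m0 S0) (ma, Sa) J \<delta>" and t: "t \<in> J"
  shows "\<delta> t = gaussian (geodesic_mean m0 A b t) (geodesic_cov S0 A t)"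
proof -
  obtain e c where e: "orthonormal_frame e" "A = spectral e c"
    using A(1) by (rule spectral_theorem)
  obtain m S where \<delta>: "\<And>t. t \<in> J \<Longrightarrow> \<delta> t = gaussian (m t) (S t)" and init: "m 0 = m0" "S 0 = S0"
    and deriv: "\<And>t. t \<in> J \<Longrightarrow> (m has_vector_derivative A *v m t + b) (at t within J)"
      "\<And>t. t \<in> J \<Longrightarrow> (S has_vector_derivative A ** S t + S t ** A) (at t within J)"
    using e1_geodesic_fromD[OF geo S0 A] by blast
  have J: "is_interval J" "0 \<in> J" using geo by (auto simp: e1_geodesic_from_def e1_geodesic_on_def)
  have "m t = geodesic_mean m0 A b t"
  proof (rule affine_vector_ode_unique[OF A(1) J t _ deriv(1)])
    show "m 0 = geodesic_mean m0 A b 0" by (simp add: init geodesic_initial[OF A(1)])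
    show "(geodesic_mean m0 A b has_vector_derivative A *v geodesic_mean m0 A b t + b) (at t within J)" for t
      unfolding e(2) by (rule geodesic_mean_derivative[OF e(1)])
  qed
  moreover have "S t = geodesic_cov S0 A t"
  proof (rule lyapunov_ode_unique[OF A(1) J t _ deriv(2)])
    show "S 0 = geodesic_cov S0 A 0" by (simp add: init geodesic_initial[OF A(1)])
    show "(geodesic_cov S0 A has_vector_derivative
        A ** geodesic_cov S0 A t + geodesic_cov S0 A t ** A) (at t within J)" for t
      unfolding e(2) by (rule geodesic_cov_derivative[OF e(1)])
  qed
  ultimately show ?thesis using \<delta>[OF t] by simp
qed

section \<open>Behaviour of geodesics for large times\<close>

text \<open>
  Convergence is asked only of the products with \<open>e i \<bullet> x\<close>, because on the kernel of \<open>A\<close> the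
  coefficient \<open>exp_primitive t 0 = t\<close> diverges, while the corresponding component of \<open>b\<close> is zero.
\<close>

lemma spectral_mult_vector_tendsto:
  assumes "\<And>i. ((\<lambda>t. f t i * (e i \<bullet> x)) \<longlongrightarrow> g i * (e i \<bullet> x)) F"
  shows "((\<lambda>t. spectral e (f t) *v x) \<longlongrightarrow> spectral e g *v x) F"
  unfolding spectral_mult_vector by (intro tendsto_intros assms)

lemma spectral_tendsto:
  assumes "\<And>i. ((\<lambda>t. f t i) \<longlongrightarrow> g i) F"
  shows "((\<lambda>t. spectral e (f t)) \<longlongrightarrow> spectral e g) F"
  unfolding spectral_def by (intro tendsto_intros assms)

lemma exp_mult_tendsto:
  fixes c :: real
  assumes "c \<le> 0"
  shows "((\<lambda>t. exp (t * c)) \<longlongrightarrow> (if c = 0 then 1 else 0)) at_top"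
proof (cases "c = 0")
  case False
  then have "c < 0" using assms by simp
  then have "filterlim (\<lambda>t. c * t) at_bot at_top"
    by (intro filterlim_tendsto_neg_mult_at_bot[OF tendsto_const _ filterlim_ident])
  from filterlim_compose[OF exp_at_bot this] False show ?thesis by (simp add: mult.commute)
qed simp

lemma exp_primitive_tendsto:
  fixes c :: real
  assumes "c < 0"
  shows "((\<lambda>t. exp_primitive t c) \<longlongrightarrow> - inverse c) at_top"
proof -
  have "((\<lambda>t. (exp (t * c) - 1) / c) \<longlongrightarrow> (0 - 1) / c) at_top"
    using exp_mult_tendsto[of c] assms by (intro tendsto_intros) auto
  then show ?thesis using assms by (simp add: exp_primitive_def inverse_eq_divide)
qed

lemma pos_semidef_limit_cov:
  assumes "symmetric_mat A" "pos_def S0"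
  shows "pos_semidef (ker_proj A ** S0 ** ker_proj A)"
proof -
  obtain e c where e: "orthonormal_frame e" "A = spectral e c"
    using assms(1) by (rule spectral_theorem)
  show ?thesis
    unfolding e(2) ker_proj_spectral[OF e(1)]
    by (intro pos_semidef_congruence symmetric_spectral pos_def_imp_pos_semidef assms)
qed

text \<open>
  The exponential tends to the projector onto the kernel, and \<open>K\<^sub>t\<close> applied to \<open>b\<close> to minus the
  pseudoinverse applied to \<open>b\<close>: on a negative eigenvalue \<open>c\<close> the integral of \<open>exp (s * c)\<close> over all
  \<open>s \<ge> 0\<close> is \<open>- 1 / c\<close>, and on the kernel \<open>b\<close> has no component.
\<close>

lemma e1_geodesic_weak_limit:
  fixes A S0 :: "real^'n^'n"
  assumes S0: "pos_def S0" and A: "neg_semidef A" "ker_proj A *v b = 0"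
  shows "weak_limit (\<lambda>t. gaussian (geodesic_mean m0 A b t) (geodesic_cov S0 A t))
    (gaussian (ker_proj A *v m0 - pinv A *v b) (ker_proj A ** S0 ** ker_proj A)) at_top"
proof -
  have sym: "symmetric_mat A" using A(1) by (simp add: neg_semidef_def)
  obtain e c where e: "orthonormal_frame e" "A = spectral e c"
    using sym by (rule spectral_theorem)
  have c: "c i \<le> 0" for i using A(1) e by (simp add: neg_semidef_spectral)
  have b: "e i \<bullet> b = 0" if "c i = 0" for i using A(2) that ker_proj_mult_eq_0_iff[OF e(1)] e(2) by blast
  let ?P = "spectral e (\<lambda>i. if c i = 0 then 1 else 0)"
  have E: "((\<lambda>t. spectral e (\<lambda>i. exp (t * c i))) \<longlongrightarrow> ?P) at_top"
    by (intro spectral_tendsto exp_mult_tendsto c)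
  note ker_proj = ker_proj_spectral[OF e(1), of c, folded e(2)]
  have "((\<lambda>t. spectral e (\<lambda>i. exp_primitive t (c i)) *v b) \<longlongrightarrow> spectral e (\<lambda>i. - inverse (c i)) *v b) at_top"
  proof (rule spectral_mult_vector_tendsto)
    fix i
    show "((\<lambda>t. exp_primitive t (c i) * (e i \<bullet> b)) \<longlongrightarrow> - inverse (c i) * (e i \<bullet> b)) at_top"
    proof (cases "c i = 0")
      case True
      then show ?thesis by (simp add: b)
    next
      case False
      then have "c i < 0" using c[of i] by simp
      then show ?thesis by (intro tendsto_mult exp_primitive_tendsto tendsto_const)
    qed
  qed
  moreover have "spectral e (\<lambda>i. - inverse (c i)) *v b = - (pinv A *v b)"
    by (simp add: e(2) pinv_spectral[OF e(1)] spectral_mult_vector sum_negf)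
  ultimately have "(geodesic_mean m0 A b \<longlongrightarrow> ?P *v m0 + - (pinv A *v b)) at_top"
    unfolding e(2) geodesic_mean_spectral[OF e(1), abs_def]
    by (intro tendsto_add bounded_linear.tendsto[OF bounded_linear_mult_vector] E) simp
  then have mean: "(geodesic_mean m0 A b \<longlongrightarrow> ker_proj A *v m0 - pinv A *v b) at_top"
    by (simp add: ker_proj)
  have cov: "(geodesic_cov S0 A \<longlongrightarrow> ker_proj A ** S0 ** ker_proj A) at_top"
    unfolding ker_proj unfolding e(2) geodesic_cov_spectral[OF e(1), abs_def]
    by (intro bounded_bilinear.tendsto[OF bounded_bilinear_matrix_mult] E tendsto_const)
  note psd = pos_semidef_limit_cov[OF sym S0]
  have "pos_semidef (geodesic_cov S0 A t)" for t
    by (intro pos_def_imp_pos_semidef pos_def_geodesic_cov sym S0)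
  then show ?thesis by (rule gaussian_weak_limitI[OF _ psd mean cov])
qed

text \<open>
  Along \<open>e i\<close> the variance is a positive constant times \<open>exp (2 * c i * t)\<close>, which must not explode;
  if \<open>c i = 0\<close> it is constant and the mean has speed \<open>e i \<bullet> b\<close>, which must vanish.
\<close>

lemma e1_geodesic_weak_limit_imp:
  fixes A S0 :: "real^'n^'n"
  assumes S0: "pos_def S0" and A: "symmetric_mat A" and S': "pos_semidef S'"
    and lim: "weak_limit (\<lambda>t. gaussian (geodesic_mean m0 A b t) (geodesic_cov S0 A t)) (gaussian m' S') at_top"
  shows "neg_semidef A" "ker_proj A *v b = 0"
proof -
  obtain e c where e: "orthonormal_frame e" "A = spectral e c"
    using A by (rule spectral_theorem)
  have psd: "pos_semidef (geodesic_cov S0 A t)" for t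
    by (intro pos_def_imp_pos_semidef pos_def_geodesic_cov A S0)
  define q where "q i = e i \<bullet> (S0 *v e i)" for i
  have q: "0 < q i" for i
    using S0 frame_nonzero[OF e(1)] by (auto simp: q_def pos_def_def)
  have var: "e i \<bullet> (geodesic_cov S0 A t *v e i) = q i * exp (2 * c i * t)" for i t
  proof -
    have "e i \<bullet> (geodesic_cov S0 A t *v e i) = exp (t * c i) * exp (t * c i) * q i"
      by (simp add: e(2) geodesic_cov_spectral[OF e(1)] congruence_quadratic_form[OF symmetric_spectral]
          spectral_mult_frame[OF e(1)] matrix_vector_mult_scaleR q_def)
    also have "\<dots> = q i * exp (2 * c i * t)" by (simp add: exp_add[symmetric] mult_ac)
    finally show ?thesis .
  qed
  have "c i \<le> 0" for i
  proof (rule ccontr)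
    assume "\<not> c i \<le> 0"
    then have "filterlim (\<lambda>t. 2 * c i * t) at_top at_top"
      by (intro filterlim_tendsto_pos_mult_at_top[OF tendsto_const _ filterlim_ident]) simp
    from filterlim_compose[OF exp_at_top this]
    have "filterlim (\<lambda>t. q i * exp (2 * c i * t)) at_top at_top"
      by (rule filterlim_tendsto_pos_mult_at_top[OF tendsto_const q])
    then show False
      using gaussian_weak_limit_variance[OF lim trivial_limit_at_top_linorder psd S', of "e i"]
      by (simp add: var)
  qed
  then show "neg_semidef A" by (simp add: e(2) neg_semidef_spectral[OF e(1)])
  have "e i \<bullet> b = 0" if "c i = 0" for i
  proof (rule gaussian_weak_limit_no_drift[OF lim psd S'])
    show "e i \<bullet> geodesic_mean m0 A b t = e i \<bullet> m0 + t * (e i \<bullet> b)" for t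
      by (simp add: e(2) geodesic_mean_spectral[OF e(1)] inner_add_right inner_frame_spectral[OF e(1)]
          that exp_primitive_def)
    show "e i \<bullet> (geodesic_cov S0 A t *v e i) = q i" for t by (simp add: var that)
  qed
  then show "ker_proj A *v b = 0" by (simp add: e(2) ker_proj_mult_eq_0_iff[OF e(1)])
qed

lemma e1_geodesic_weak_limit_neg_def:
  fixes A S0 :: "real^'n^'n"
  assumes S0: "pos_def S0" and A: "neg_def A"
  shows "weak_limit (\<lambda>t. gaussian (geodesic_mean m0 A b t) (geodesic_cov S0 A t))
    (return borel (- (matrix_inv A *v b))) at_top"
proof -
  have sym: "symmetric_mat A" using A by (simp add: neg_def_def)
  then obtain e c where e: "orthonormal_frame e" "A = spectral e c"
    by (rule spectral_theorem)
  have c: "c i < 0" for i using A e(2) neg_def_spectralD[OF e(1)] by blast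
  then have c0: "c i \<noteq> 0" for i by (metis less_irrefl)
  have P: "ker_proj A = 0" by (simp add: e(2) ker_proj_spectral[OF e(1)] c0 spectral_zero)
  have "pinv A = matrix_inv A"
    by (simp add: e(2) pinv_spectral[OF e(1)] matrix_inv_spectral[OF e(1) c0])
  moreover have "neg_semidef A"
    using c by (simp add: e(2) neg_semidef_spectral[OF e(1)] less_imp_le)
  moreover have "(0 :: real^'n^'n) ** S0 ** 0 = 0" by (simp add: vec_eq_iff matrix_matrix_mult_def)
  ultimately show ?thesis
    using e1_geodesic_weak_limit[OF S0, of A b m0] by (simp add: P gaussian_zero_covariance)
qed

lemma stationary_e1_geodesic:
  fixes m0 :: "real^'n" and S0 :: "real^'n^'n"
  shows "geodesic_mean m0 0 0 t = m0" "geodesic_cov S0 0 t = S0"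
proof -
  have "symmetric_mat (0 :: real^'n^'n)" by (simp add: symmetric_mat_def transpose_def vec_eq_iff)
  from geodesic_initial(1)[OF this, of m0 0] geodesic_initial(2)[OF this, of S0]
  show "geodesic_mean m0 0 0 t = m0" "geodesic_cov S0 0 t = S0"
    by (simp_all add: geodesic_mean_def geodesic_cov_def)
qed

text \<open>
  By uniqueness of weak limits the covariance of a nondegenerate limit is the projected one, which
  vanishes on every eigenvector of \<open>A\<close> with nonzero eigenvalue. So there is none, \<open>A\<close> is zero, the
  projector is the identity, and the kernel condition reads \<open>b = 0\<close>.
\<close>

lemma e1_geodesic_nondegenerate_limit_iff:
  fixes A S0 :: "real^'n^'n"
  assumes S0: "pos_def S0" and A: "symmetric_mat A"
  shows "(\<exists>M\<in>nondeg_gaussians.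
      weak_limit (\<lambda>t. gaussian (geodesic_mean m0 A b t) (geodesic_cov S0 A t)) M at_top)
    \<longleftrightarrow> A = 0 \<and> b = 0" (is "?lim \<longleftrightarrow> _")
proof
  assume ?lim
  then obtain m' S' where S': "pos_def S'"
    and lim: "weak_limit (\<lambda>t. gaussian (geodesic_mean m0 A b t) (geodesic_cov S0 A t)) (gaussian m' S') at_top"
    by (auto simp: nondeg_gaussians_def)
  note psd' = pos_def_imp_pos_semidef[OF S']
  note cond = e1_geodesic_weak_limit_imp[OF S0 A psd' lim]
  obtain e c where e: "orthonormal_frame e" "A = spectral e c"
    using A by (rule spectral_theorem)
  note ker_proj = ker_proj_spectral[OF e(1), of c, folded e(2)]
  have "S' = ker_proj A ** S0 ** ker_proj A"
  proof (rule gaussian_weak_limit_unique(2)[OF trivial_limit_at_top_linorder _ psd' _ lim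
        e1_geodesic_weak_limit[OF S0 cond]])
    show "pos_semidef (geodesic_cov S0 A t)" for t
      by (intro pos_def_imp_pos_semidef pos_def_geodesic_cov A S0)
    show "pos_semidef (ker_proj A ** S0 ** ker_proj A)" by (rule pos_semidef_limit_cov[OF A S0])
  qed
  then have quad: "e i \<bullet> (S' *v e i) = (ker_proj A *v e i) \<bullet> (S0 *v (ker_proj A *v e i))" for i
    by (simp add: ker_proj congruence_quadratic_form[OF symmetric_spectral])
  have "c i = 0" for i
  proof (rule ccontr)
    assume "c i \<noteq> 0"
    then have "ker_proj A *v e i = 0" by (simp add: ker_proj spectral_mult_frame[OF e(1)])
    then have "e i \<bullet> (S' *v e i) = 0" by (simp add: quad)
    then show False using S' frame_nonzero[OF e(1), of i] by (auto simp: pos_def_def)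
  qed
  then have c: "c = (\<lambda>_. 0)" by auto
  have "ker_proj A = mat 1" by (simp add: ker_proj c spectral_one[OF e(1)])
  then show "A = 0 \<and> b = 0" using cond(2) by (simp add: e(2) c spectral_zero)
next
  assume "A = 0 \<and> b = 0"
  moreover have "gaussian m0 S0 \<in> nondeg_gaussians" using S0 by (auto simp: nondeg_gaussians_def)
  ultimately show ?lim
    by (intro bexI[of _ "gaussian m0 S0"]) (auto simp: stationary_e1_geodesic weak_limit_def)
qed

lemma e1_geodesically_complete: "e1_geodesically_complete TYPE('n::finite)"
  unfolding e1_geodesically_complete_def
proof (intro ballI allI impI)
  fix \<mu> :: "(real^'n) measure" and mv :: "real^'n" and Sv :: "real^'n^'n"
  assume "\<mu> \<in> nondeg_gaussians" and Sv: "symmetric_mat Sv"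
  then obtain m S where \<mu>: "\<mu> = gaussian m S" and S: "pos_def S"
    by (auto simp: nondeg_gaussians_def)
  obtain A b where A: "symmetric_mat A" "A ** S + S ** A = Sv" "A *v m + b = mv"
    using ex1_implies_ex[OF e1_representative_unique[OF S Sv, of m mv]] by auto
  let ?\<gamma> = "\<lambda>t. gaussian (geodesic_mean m A b t) (geodesic_cov S A t)"
  have "e1_geodesic_from \<mu> (mv, Sv) UNIV ?\<gamma>"
    unfolding \<mu> by (rule e1_geodesic_exists[OF S A])
  moreover have "\<forall>J \<delta>. e1_geodesic_from \<mu> (mv, Sv) J \<delta> \<longrightarrow> (\<forall>t\<in>J. \<delta> t = ?\<gamma> t)"
    using e1_geodesic_unique[OF S A] \<mu> by blast
  ultimately show "\<exists>\<gamma>. e1_geodesic_from \<mu> (mv, Sv) UNIV \<gamma> \<and>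
      (\<forall>J \<delta>. e1_geodesic_from \<mu> (mv, Sv) J \<delta> \<longrightarrow> (\<forall>t\<in>J. \<delta> t = \<gamma> t))" by blast
qed

theorem proposition5:
  fixes m0 ma :: "real^'n" and \<Sigma>0 \<Sigma>a :: "real^'n^'n"
  assumes "pos_def \<Sigma>0" and "symmetric_mat \<Sigma>a"
  shows
    "(\<exists>!p. case p of (A, b) \<Rightarrow>
        symmetric_mat A \<and> A ** \<Sigma>0 + \<Sigma>0 ** A = \<Sigma>a \<and> A *v m0 + b = ma) \<and>
     (\<forall>A b \<gamma>1.
        symmetric_mat A \<and> A ** \<Sigma>0 + \<Sigma>0 ** A = \<Sigma>a \<and> A *v m0 + b = ma \<and>
        \<gamma>1 = (\<lambda>t. gaussian (mat_exp (t *\<^sub>R A) *v m0 + exp_integral t A *v b)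
                          (mat_exp (t *\<^sub>R A) ** \<Sigma>0 ** mat_exp (t *\<^sub>R A)))
        \<longrightarrow>
        e1_geodesic_from (gaussian m0 \<Sigma>0) (ma, \<Sigma>a) UNIV \<gamma>1 \<and>
        (\<forall>J \<delta>. e1_geodesic_from (gaussian m0 \<Sigma>0) (ma, \<Sigma>a) J \<delta> \<longrightarrow>
           (\<forall>t\<in>J. \<delta> t = \<gamma>1 t)) \<and>
        (\<forall>t. \<gamma>1 t \<in> nondeg_gaussians) \<and>
        ((\<exists>M\<in>closed_gaussians. weak_limit \<gamma>1 M at_top) \<longleftrightarrow>
           neg_semidef A \<and> ker_proj A *v b = 0) \<and>
        (neg_semidef A \<and> ker_proj A *v b = 0 \<longrightarrow>
           gaussian (ker_proj A *v m0 - pinv A *v b) (ker_proj A ** \<Sigma>0 ** ker_proj A)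
             \<in> closed_gaussians \<and>
           weak_limit \<gamma>1
             (gaussian (ker_proj A *v m0 - pinv A *v b) (ker_proj A ** \<Sigma>0 ** ker_proj A))
             at_top) \<and>
        (neg_def A \<longrightarrow>
           weak_limit \<gamma>1 (return borel (- (matrix_inv A *v b))) at_top) \<and>
        ((\<exists>M\<in>nondeg_gaussians. weak_limit \<gamma>1 M at_top) \<longleftrightarrow> A = 0 \<and> b = 0) \<and>
        (A = 0 \<and> b = 0 \<longrightarrow> (\<forall>t. \<gamma>1 t = gaussian m0 \<Sigma>0))) \<and>
     e1_geodesically_complete TYPE('n)"
proof (intro conjI allI impI)
  show "\<exists>!p. case p of (A, b) \<Rightarrow>
      symmetric_mat A \<and> A ** \<Sigma>0 + \<Sigma>0 ** A = \<Sigma>a \<and> A *v m0 + b = ma"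
    by (rule e1_representative_unique[OF assms])
  show "e1_geodesically_complete TYPE('n)" by (rule e1_geodesically_complete)
next
  fix A :: "real^'n^'n" and b :: "real^'n" and \<gamma>1 :: "real \<Rightarrow> (real^'n) measure"
  assume *: "symmetric_mat A \<and> A ** \<Sigma>0 + \<Sigma>0 ** A = \<Sigma>a \<and> A *v m0 + b = ma \<and>
    \<gamma>1 = (\<lambda>t. gaussian (mat_exp (t *\<^sub>R A) *v m0 + exp_integral t A *v b)
                      (mat_exp (t *\<^sub>R A) ** \<Sigma>0 ** mat_exp (t *\<^sub>R A)))"
  then have A: "symmetric_mat A" "A ** \<Sigma>0 + \<Sigma>0 ** A = \<Sigma>a" "A *v m0 + b = ma" by blast+
  have \<gamma>1: "\<gamma>1 = (\<lambda>t. gaussian (geodesic_mean m0 A b t) (geodesic_cov \<Sigma>0 A t))"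
    using * by (simp only: geodesic_mean_def geodesic_cov_def)
  note S0 = assms(1)
  let ?M = "gaussian (ker_proj A *v m0 - pinv A *v b) (ker_proj A ** \<Sigma>0 ** ker_proj A)"
  show "e1_geodesic_from (gaussian m0 \<Sigma>0) (ma, \<Sigma>a) UNIV \<gamma>1"
    unfolding \<gamma>1 by (rule e1_geodesic_exists[OF S0 A])
  show "\<forall>t\<in>J. \<delta> t = \<gamma>1 t" if "e1_geodesic_from (gaussian m0 \<Sigma>0) (ma, \<Sigma>a) J \<delta>" for J \<delta>
    unfolding \<gamma>1 using e1_geodesic_unique[OF S0 A that] by blast
  show "\<gamma>1 t \<in> nondeg_gaussians" for t
    unfolding \<gamma>1 nondeg_gaussians_def using pos_def_geodesic_cov[OF A(1) S0] by blast
  show closed: "?M \<in> closed_gaussians"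
    unfolding closed_gaussians_def using pos_semidef_limit_cov[OF A(1) S0] by blast
  show lim: "weak_limit \<gamma>1 ?M at_top" if "neg_semidef A \<and> ker_proj A *v b = 0"
    unfolding \<gamma>1 using that by (intro e1_geodesic_weak_limit[OF S0]) blast+
  show "(\<exists>M\<in>closed_gaussians. weak_limit \<gamma>1 M at_top) \<longleftrightarrow> neg_semidef A \<and> ker_proj A *v b = 0"
  proof
    assume "\<exists>M\<in>closed_gaussians. weak_limit \<gamma>1 M at_top"
    then obtain m' S' where "pos_semidef S'" "weak_limit \<gamma>1 (gaussian m' S') at_top"
      by (auto simp: closed_gaussians_def)
    then show "neg_semidef A \<and> ker_proj A *v b = 0"
      unfolding \<gamma>1 using e1_geodesic_weak_limit_imp[OF S0 A(1)] by blast
  qed (use closed lim in blast)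
  show "weak_limit \<gamma>1 (return borel (- (matrix_inv A *v b))) at_top" if "neg_def A"
    unfolding \<gamma>1 by (rule e1_geodesic_weak_limit_neg_def[OF S0 that])
  show "(\<exists>M\<in>nondeg_gaussians. weak_limit \<gamma>1 M at_top) \<longleftrightarrow> A = 0 \<and> b = 0"
    unfolding \<gamma>1 by (rule e1_geodesic_nondegenerate_limit_iff[OF S0 A(1)])
  show "\<gamma>1 t = gaussian m0 \<Sigma>0" if "A = 0 \<and> b = 0" for t
    unfolding \<gamma>1 using that by (simp add: stationary_e1_geodesic)
qed

end
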